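(* Let $U$, $V$ and $W$ be absolute matrix order unit spaces satisfying condition (T). Then: (a) $K_0(I_V)=I_{K_0(V)}$, where $I_V$ and $I_{K_0(V)}$ are the identity maps; (b) if $\phi:U\to V$ and $\psi:V\to W$ are unital completely $|\cdot|$-preserving maps, then $K_0(\psi\circ\phi)=K_0(\psi)\circ K_0(\phi)$; (c) $K_0(0_{W,V})=0_{K_0(W),K_0(V)}$, where $0_{W,V}:V\to W$ is the zero map and $0_{K_0(W),K_0(V)}:K_0(V)\to K_0(W)$ is the zero homomorphism.
   Context: **Absolute matrix order unit spaces.** $M_{m,n}(V)$ denotes $m\times n$ matrices over $V$, $M_{m,n}=M_{m,n}(\mathbb C)$ with operator norm, $v\oplus w$ is the block diagonal matrix, $0_n$ the zero of $M_n(V)$. A matrix ordered space is a complex vector space $V$ with involution (with $[v_{ij}]^*=[v_{ji}^*]$ on matrices) and cones $M_n(V)^+\subset M_n(V)_{sa}$ such that each $(M_n(V)_{sa},M_n(V)^+)$ is a real ordered vector space and $a^*va\in M_m(V)^+$ for $v\in M_n(V)^+$, $a\in M_{n,m}$. It is a matrix order unit space with order unit $e\in V^+$ if $e$ is an order unit for $V_{sa}$, $V^+$ is proper and every $M_n(V)^+$ is Archimedean (if $u\in M_n(V)^+$, $v\in M_n(V)_{sa}$ and $ku+v\in M_n(V)^+$ for all $k>0$, then $v\in M_n(V)^+$). Put $e^n=e\oplus\cdots\oplus e\in M_n(V)$ and $\|v\|_n=\inf\left\{k>0:\begin{bmatrix} ke^n & v \\ v^* & ke^n \end{bmatrix}\in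 M_{2n}(V)^+\right\}$. An absolutely ordered space $(X,X^+,|\cdot|)$ is a real ordered vector space with $|\cdot|:X\to X^+$ such that: $|v|=v$ for $v\in X^+$; $|v|\pm v\in X^+$; $|kv|=|k||v|$ for $k\in\mathbb R$; if $|u-v|=u+v$ and $0\le w\le v$ then $|u-w|=u+w$; if $|u-v|=u+v$ and $|u-w|=u+w$ then $\big|u-|v\pm w|\big|=u+|v\pm w|$. For $u,v\in X^+$ write $u\perp v$ if $|u-v|=u+v$. An absolute matrix order unit space is a matrix order unit space $(V,\{M_n(V)^+\},e)$ with maps $|\cdot|_{m,n}:M_{m,n}(V)\to M_n(V)^+$ ($|\cdot|_n:=|\cdot|_{n,n}$) such that: (1) each $(M_n(V)_{sa},M_n(V)^+,|\cdot|_n)$ is an absolutely ordered space; (2) $|\alpha v\beta|_{r,s}\le\|\alpha\|\,\big||v|_{m,n}\beta\big|_{n,s}$ for $v\in M_{m,n}(V)$, $\alpha\in M_{r,m}$, $\beta\in M_{n,s}$; (3) $|v\oplus w|_{m+r,n+s}=|v|_{m,n}\oplus|w|_{r,s}$; (4) $\perp=\perp^a_\infty$ on each $M_n(V)^+$, where $u\perp_\infty v$ means $\|k_1u+k_2v\|_n=\max\{\|k_1u\|_n,\|k_2v\|_n\}$ for all $k_1,k_2\in\mathbb R$, and $u\perp^a_\infty v$ means $u_1\perp_\infty v_1$ whenever $0\le u_1\le u$, $0\le v_1\le v$. **Projections and equivalence.** $p\in M_n(V)$ is an order projection if $p^*=p$ and $|2p-e^n|_n=e^n$; $\mathcal{OP}_n(V)$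 is the set of these, $\mathcal{OP}(V)=\mathcal{OP}_1(V)$, and $\mathcal{OP}_\infty(V)=\bigcup_n\mathcal{OP}_n(V)$. $v\in M_{m,n}(V)$ is a partial isometry ($v\in\mathcal{PI}_{m,n}(V)$) if $|v|_{m,n}$ and $|v^*|_{n,m}$ are order projections. For $p\in\mathcal{OP}_m(V)$, $q\in\mathcal{OP}_n(V)$, $p\sim q$ means there is $v\in\mathcal{PI}_{m,n}(V)$ with $p=|v^*|_{n,m}$ and $q=|v|_{m,n}$. For $p,q\in\mathcal{OP}_\infty(V)$, $p\approx q$ means $p\oplus r\sim q\oplus r$ for some $r\in\mathcal{OP}_\infty(V)$. **Condition (T):** if $u\in\mathcal{PI}_{m,n}(V)$, $v\in\mathcal{PI}_{l,n}(V)$ and $|u|_{m,n}=|v|_{l,n}$, then there is $w\in\mathcal{PI}_{m,l}(V)$ with $|w^*|_{l,m}=|u^*|_{n,m}$ and $|w|_{m,l}=|v^*|_{n,l}$. **$K_0(V)$** (for $V$ satisfying (T)): the abelian group of equivalence classes $[(p,q)]$ of pairs in $\mathcal{OP}_\infty(V)\times\mathcal{OP}_\infty(V)$ under $(p_1,q_1)\equiv(p_2,q_2)\iff p_1\oplus q_2\approx p_2\oplus q_1$, with $[(p_1,q_1)]+[(p_2,q_2)]=[(p_1\oplus p_2,q_1\oplus q_2)]$, identity $[(0,0)]$ and $-[(p,q)]=[(q,p)]$. **Maps.** For a linear $\phi:V\to W$, $\phi_n:M_n(V)\to M_n(W)$ is the entrywise amplification; $\phi$ applied to an element of $M_n(V)$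 means $\phi_n$. A $*$-linear map $\phi$ is completely $|\cdot|$-preserving if $|\phi_n(v)|_n=\phi_n(|v|_n)$ for all $v\in M_n(V)$, $n\in\mathbb N$; unital means it maps order unit to order unit. For a completely $|\cdot|$-preserving $\phi:V\to W$ with $\phi(e_V)\in\mathcal{OP}(W)$ ($V,W$ satisfying (T)), $\phi$ maps $\mathcal{OP}_\infty(V)$ into $\mathcal{OP}_\infty(W)$ and $K_0(\phi):K_0(V)\to K_0(W)$ is the unique group homomorphism with $K_0(\phi)([(p,0)])=[(\phi(p),0)]$ for all $p\in\mathcal{OP}_\infty(V)$. *)

theory Defs
  imports "HOL-Analysis.L2_Norm" "HOL-Algebra.Group" "HOL-Library.FuncSet"
    "Jordan_Normal_Form.Matrix"
begin

section \<open>Matrices over a complex vector space with involution\<close>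

text \<open>
  The vector space is the whole type \<open>'v\<close>; \<open>M\<^sub>m\<^sub>,\<^sub>n(V)\<close> is \<^term>\<open>carrier_mat m n\<close>.
  A matrix carries its dimensions, so one function \<open>absv\<close> represents the whole family
  \<open>|\<cdot>|\<^sub>m\<^sub>,\<^sub>n\<close>. Matrix sizes are at least 1 throughout.
\<close>

record 'v amous =
  scl :: "complex \<Rightarrow> 'v \<Rightarrow> 'v"
  invol :: "'v \<Rightarrow> 'v"
  pcone :: "nat \<Rightarrow> 'v mat set"
  ounit :: 'v
  absv :: "'v mat \<Rightarrow> 'v mat"

definition mat_star :: "('a \<Rightarrow> 'a) \<Rightarrow> 'a mat \<Rightarrow> 'a mat" where
  "mat_star s A = map_mat s (transpose_mat A)"

abbreviation mstar :: "('v, 'z) amous_scheme \<Rightarrow> 'v mat \<Rightarrow> 'v mat" where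
  "mstar V \<equiv> mat_star (invol V)"

definition rscl :: "('v, 'z) amous_scheme \<Rightarrow> real \<Rightarrow> 'v mat \<Rightarrow> 'v mat" where
  "rscl V k A = map_mat (scl V (complex_of_real k)) A"

definition lmul :: "('v::ab_group_add, 'z) amous_scheme \<Rightarrow> complex mat \<Rightarrow> 'v mat \<Rightarrow> 'v mat" where
  "lmul V \<alpha> A = mat (dim_row \<alpha>) (dim_col A)
     (\<lambda>(i, j). \<Sum>k<dim_row A. scl V (\<alpha> $$ (i, k)) (A $$ (k, j)))"

definition rmul :: "('v::ab_group_add, 'z) amous_scheme \<Rightarrow> 'v mat \<Rightarrow> complex mat \<Rightarrow> 'v mat" where
  "rmul V A \<beta> = mat (dim_row A) (dim_col \<beta>)
     (\<lambda>(i, j). \<Sum>k<dim_col A. scl V (\<beta> $$ (k, j)) (A $$ (i, k)))"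

definition msum :: "'v::zero mat \<Rightarrow> 'v mat \<Rightarrow> 'v mat" where
  "msum A B = four_block_mat A (0\<^sub>m (dim_row A) (dim_col B)) (0\<^sub>m (dim_row B) (dim_col A)) B"

definition Msa :: "('v, 'z) amous_scheme \<Rightarrow> nat \<Rightarrow> 'v mat set" where
  "Msa V n = {A \<in> carrier_mat n n. mstar V A = A}"

definition unit_mat :: "('v::zero, 'z) amous_scheme \<Rightarrow> nat \<Rightarrow> 'v mat" where
  "unit_mat V n = mat n n (\<lambda>(i, j). if i = j then ounit V else 0)"

definition mle :: "('v::ab_group_add, 'z) amous_scheme \<Rightarrow> nat \<Rightarrow> 'v mat \<Rightarrow> 'v mat \<Rightarrow> bool" where
  "mle V n u v \<longleftrightarrow> u \<in> Msa V n \<and> v \<in> Msa V n \<and> v - u \<in> pcone V n"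

definition mnorm :: "('v::ab_group_add, 'z) amous_scheme \<Rightarrow> nat \<Rightarrow> 'v mat \<Rightarrow> real" where
  "mnorm V n v = Inf {k. k > 0 \<and>
     four_block_mat (rscl V k (unit_mat V n)) v (mstar V v) (rscl V k (unit_mat V n))
       \<in> pcone V (2 * n)}"

definition l2norm :: "complex vec \<Rightarrow> real" where
  "l2norm x = L2_set (\<lambda>i. cmod (x $ i)) {..<dim_vec x}"

definition opnorm :: "complex mat \<Rightarrow> real" where
  "opnorm \<alpha> = Sup {l2norm (\<alpha> *\<^sub>v x) | x. x \<in> carrier_vec (dim_col \<alpha>) \<and> l2norm x \<le> 1}"

section \<open>Absolute matrix order unit spaces\<close>

locale matrix_ordered_space =
  vector_space "scl V" for V :: "('v::ab_group_add, 'z) amous_scheme" (structure) +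
  assumes invol_add: "invol V (x + y) = invol V x + invol V y"
    and invol_scl: "invol V (scl V c x) = scl V (cnj c) (invol V x)"
    and invol_invol: "invol V (invol V x) = x"
    and cone_sa: "0 < n \<Longrightarrow> pcone V n \<subseteq> Msa V n"
    and cone_zero: "0 < n \<Longrightarrow> 0\<^sub>m n n \<in> pcone V n"
    and cone_add: "\<lbrakk>0 < n; u \<in> pcone V n; v \<in> pcone V n\<rbrakk> \<Longrightarrow> u + v \<in> pcone V n"
    and cone_rscl: "\<lbrakk>0 < n; u \<in> pcone V n; 0 \<le> k\<rbrakk> \<Longrightarrow> rscl V k u \<in> pcone V n"
    and cone_conj: "\<lbrakk>0 < m; 0 < n; v \<in> pcone V n; a \<in> carrier_mat n m\<rbrakk>
      \<Longrightarrow> rmul V (lmul V (mat_star cnj a) v) a \<in> pcone V m"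

locale matrix_order_unit_space = matrix_ordered_space +
  assumes unit_pos: "unit_mat V 1 \<in> pcone V 1"
    and order_unit: "v \<in> Msa V 1 \<Longrightarrow> \<exists>k>0. rscl V k (unit_mat V 1) + v \<in> pcone V 1
      \<and> rscl V k (unit_mat V 1) - v \<in> pcone V 1"
    and proper: "\<lbrakk>v \<in> pcone V 1; - v \<in> pcone V 1\<rbrakk> \<Longrightarrow> v = 0\<^sub>m 1 1"
    and archimedean: "\<lbrakk>0 < n; u \<in> pcone V n; v \<in> Msa V n;
      \<And>k. k > 0 \<Longrightarrow> rscl V k u + v \<in> pcone V n\<rbrakk> \<Longrightarrow> v \<in> pcone V n"

text \<open>
  The axioms of an absolutely ordered space, for the real ordered vector space
  \<open>(M\<^sub>n(V)\<^sub>s\<^sub>a, M\<^sub>n(V)\<^sup>+)\<close> with the map \<open>|\<cdot>|\<^sub>n\<close>.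
\<close>

definition absolutely_ordered :: "('v::ab_group_add, 'z) amous_scheme \<Rightarrow> nat \<Rightarrow> bool" where
  "absolutely_ordered V n \<longleftrightarrow>
     (\<forall>v \<in> Msa V n. absv V v \<in> pcone V n) \<and>
     (\<forall>v \<in> pcone V n. absv V v = v) \<and>
     (\<forall>v \<in> Msa V n. absv V v + v \<in> pcone V n \<and> absv V v - v \<in> pcone V n) \<and>
     (\<forall>v \<in> Msa V n. \<forall>k. absv V (rscl V k v) = rscl V \<bar>k\<bar> (absv V v)) \<and>
     (\<forall>u \<in> Msa V n. \<forall>v \<in> Msa V n. \<forall>w \<in> Msa V n.
        absv V (u - v) = u + v \<and> mle V n (0\<^sub>m n n) w \<and> mle V n w v
          \<longrightarrow> absv V (u - w) = u + w) \<and>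
     (\<forall>u \<in> Msa V n. \<forall>v \<in> Msa V n. \<forall>w \<in> Msa V n.
        absv V (u - v) = u + v \<and> absv V (u - w) = u + w
          \<longrightarrow> absv V (u - absv V (v + w)) = u + absv V (v + w)
            \<and> absv V (u - absv V (v - w)) = u + absv V (v - w))"

definition orth :: "('v::ab_group_add, 'z) amous_scheme \<Rightarrow> 'v mat \<Rightarrow> 'v mat \<Rightarrow> bool" where
  "orth V u v \<longleftrightarrow> absv V (u - v) = u + v"

definition orth_inf :: "('v::ab_group_add, 'z) amous_scheme \<Rightarrow> nat \<Rightarrow> 'v mat \<Rightarrow> 'v mat \<Rightarrow> bool" where
  "orth_inf V n u v \<longleftrightarrow> (\<forall>k1 k2 :: real.
     mnorm V n (rscl V k1 u + rscl V k2 v) = max (mnorm V n (rscl V k1 u)) (mnorm V n (rscl V k2 v)))"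

definition orth_inf_abs :: "('v::ab_group_add, 'z) amous_scheme \<Rightarrow> nat \<Rightarrow> 'v mat \<Rightarrow> 'v mat \<Rightarrow> bool" where
  "orth_inf_abs V n u v \<longleftrightarrow> (\<forall>u1 v1.
     mle V n (0\<^sub>m n n) u1 \<and> mle V n u1 u \<and> mle V n (0\<^sub>m n n) v1 \<and> mle V n v1 v
       \<longrightarrow> orth_inf V n u1 v1)"

locale absolute_matrix_order_unit_space = matrix_order_unit_space +
  assumes absv_pos: "\<lbrakk>0 < m; 0 < n; v \<in> carrier_mat m n\<rbrakk> \<Longrightarrow> absv V v \<in> pcone V n"
    and absv_ordered: "0 < n \<Longrightarrow> absolutely_ordered V n"
    and absv_mul: "\<lbrakk>0 < m; 0 < n; 0 < r; 0 < s; v \<in> carrier_mat m n;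
      \<alpha> \<in> carrier_mat r m; \<beta> \<in> carrier_mat n s\<rbrakk>
      \<Longrightarrow> mle V s (absv V (rmul V (lmul V \<alpha> v) \<beta>))
                  (rscl V (opnorm \<alpha>) (absv V (rmul V (absv V v) \<beta>)))"
    and absv_msum: "\<lbrakk>0 < m; 0 < n; 0 < r; 0 < s; v \<in> carrier_mat m n; w \<in> carrier_mat r s\<rbrakk>
      \<Longrightarrow> absv V (msum v w) = msum (absv V v) (absv V w)"
    and orth_eq: "\<lbrakk>0 < n; u \<in> pcone V n; v \<in> pcone V n\<rbrakk>
      \<Longrightarrow> orth V u v \<longleftrightarrow> orth_inf_abs V n u v"

section \<open>Order projections and their equivalence\<close>

definition OP :: "('v::ab_group_add, 'z) amous_scheme \<Rightarrow> nat \<Rightarrow> 'v mat set" where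
  "OP V n = {p \<in> carrier_mat n n. mstar V p = p
     \<and> absv V (rscl V 2 p - unit_mat V n) = unit_mat V n}"

definition OP_inf :: "('v::ab_group_add, 'z) amous_scheme \<Rightarrow> 'v mat set" where
  "OP_inf V = (\<Union>n\<in>{1..}. OP V n)"

definition PI :: "('v::ab_group_add, 'z) amous_scheme \<Rightarrow> nat \<Rightarrow> nat \<Rightarrow> 'v mat set" where
  "PI V m n = {v \<in> carrier_mat m n. absv V v \<in> OP V n \<and> absv V (mstar V v) \<in> OP V m}"

definition proj_equiv :: "('v::ab_group_add, 'z) amous_scheme \<Rightarrow> 'v mat \<Rightarrow> 'v mat \<Rightarrow> bool" where
  "proj_equiv V p q \<longleftrightarrow>
     (\<exists>v \<in> PI V (dim_row p) (dim_row q). p = absv V (mstar V v) \<and> q = absv V v)"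

definition stable_equiv :: "('v::ab_group_add, 'z) amous_scheme \<Rightarrow> 'v mat \<Rightarrow> 'v mat \<Rightarrow> bool" where
  "stable_equiv V p q \<longleftrightarrow> (\<exists>r \<in> OP_inf V. proj_equiv V (msum p r) (msum q r))"

definition condition_T :: "('v::ab_group_add, 'z) amous_scheme \<Rightarrow> bool" where
  "condition_T V \<longleftrightarrow> (\<forall>l m n. 0 < l \<and> 0 < m \<and> 0 < n \<longrightarrow>
     (\<forall>u \<in> PI V m n. \<forall>v \<in> PI V l n. absv V u = absv V v \<longrightarrow>
        (\<exists>w \<in> PI V m l. absv V (mstar V w) = absv V (mstar V u)
                     \<and> absv V w = absv V (mstar V v))))"

section \<open>The group \<open>K\<^sub>0(V)\<close> and the induced homomorphisms\<close>

definition K0_rel :: "('v::ab_group_add, 'z) amous_scheme \<Rightarrow> (('v mat \<times> 'v mat) \<times> ('v mat \<times> 'v mat)) set" where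
  "K0_rel V = {((p1, q1), (p2, q2)).
     p1 \<in> OP_inf V \<and> q1 \<in> OP_inf V \<and> p2 \<in> OP_inf V \<and> q2 \<in> OP_inf V
     \<and> stable_equiv V (msum p1 q2) (msum p2 q1)}"

definition K0_class :: "('v::ab_group_add, 'z) amous_scheme \<Rightarrow> 'v mat \<Rightarrow> 'v mat \<Rightarrow> ('v mat \<times> 'v mat) set" where
  "K0_class V p q = K0_rel V `` {(p, q)}"

text \<open>
  The union over representatives is the usual quotient construction: all the classes in the
  union coincide. The zero projection in \<open>[(0, 0)]\<close> is taken in \<open>M\<^sub>1(V)\<close>.
\<close>

definition K0 :: "('v::ab_group_add, 'z) amous_scheme \<Rightarrow> ('v mat \<times> 'v mat) set monoid" where
  "K0 V = \<lparr>carrier = (OP_inf V \<times> OP_inf V) // K0_rel V,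
     mult = (\<lambda>X Y. \<Union>(p1, q1)\<in>X. \<Union>(p2, q2)\<in>Y. K0_class V (msum p1 p2) (msum q1 q2)),
     one = K0_class V (0\<^sub>m 1 1) (0\<^sub>m 1 1)\<rparr>"

definition star_linear ::
  "('v::ab_group_add, 'y) amous_scheme \<Rightarrow> ('w::ab_group_add, 'z) amous_scheme \<Rightarrow> ('v \<Rightarrow> 'w) \<Rightarrow> bool" where
  "star_linear V W \<phi> \<longleftrightarrow> Vector_Spaces.linear (scl V) (scl W) \<phi>
     \<and> (\<forall>x. \<phi> (invol V x) = invol W (\<phi> x))"

definition completely_abs_preserving ::
  "('v::ab_group_add, 'y) amous_scheme \<Rightarrow> ('w::ab_group_add, 'z) amous_scheme \<Rightarrow> ('v \<Rightarrow> 'w) \<Rightarrow> bool" where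
  "completely_abs_preserving V W \<phi> \<longleftrightarrow> star_linear V W \<phi> \<and>
     (\<forall>n>0. \<forall>v \<in> carrier_mat n n. absv W (map_mat \<phi> v) = map_mat \<phi> (absv V v))"

definition unital ::
  "('v, 'y) amous_scheme \<Rightarrow> ('w, 'z) amous_scheme \<Rightarrow> ('v \<Rightarrow> 'w) \<Rightarrow> bool" where
  "unital V W \<phi> \<longleftrightarrow> \<phi> (ounit V) = ounit W"

text \<open>
  Homomorphisms are made \<^const>\<open>extensional\<close> so that they are determined by their values on
  the carrier, as the definite description requires.
\<close>

definition K0_map ::
  "('v::ab_group_add, 'y) amous_scheme \<Rightarrow> ('w::ab_group_add, 'z) amous_scheme \<Rightarrow> ('v \<Rightarrow> 'w)
    \<Rightarrow> ('v mat \<times> 'v mat) set \<Rightarrow> ('w mat \<times> 'w mat) set" where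
  "K0_map V W \<phi> = (THE h. h \<in> hom (K0 V) (K0 W) \<and> h \<in> extensional (carrier (K0 V)) \<and>
     (\<forall>p \<in> OP_inf V. h (K0_class V p (0\<^sub>m 1 1)) = K0_class W (map_mat \<phi> p) (0\<^sub>m 1 1)))"

end

theory Submission
  imports Defs
begin

text \<open>
  A homomorphism out of \<open>K\<^sub>0(V)\<close> is determined by its values on the classes \<open>[(p, 0)]\<close>, because
  \<open>[(p, q)] + [(q, 0)] = [(p, 0)]\<close> and the target is cancellative; so each of the three
  identities follows once the claimed map is seen to be a homomorphism with the right values there.
  For this the direct sum must be commutative up to \<open>\<sim>\<close>, and \<open>p \<oplus> 0 \<sim> p\<close>. Both
  rest on one remark: if \<open>\<alpha>\<close> and \<open>\<alpha>'\<close> are scalar contractions with \<open>\<alpha>'\<alpha>v = v\<close>, then axiom (2) gives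
  \<open>|\<alpha>v| \<le> |v| = |\<alpha>'\<alpha>v| \<le> |\<alpha>v|\<close>. It is applied to (partial) permutation matrices, which
  turn \<open>q \<oplus> p\<close> into the partial isometry with off-diagonal blocks \<open>p\<close> and \<open>q\<close>.
\<close>

section \<open>Matrices and block sums\<close>

lemma dim_mat_star [simp]:
  "dim_row (mat_star s A) = dim_col A" "dim_col (mat_star s A) = dim_row A"
  by (simp_all add: mat_star_def)

lemma mat_star_carrier [simp]: "A \<in> carrier_mat m n \<Longrightarrow> mat_star s A \<in> carrier_mat n m"
  by (auto simp: mat_star_def)

lemma mat_star_index [simp]:
  "i < dim_col A \<Longrightarrow> j < dim_row A \<Longrightarrow> mat_star s A $$ (i, j) = s (A $$ (j, i))"
  by (simp add: mat_star_def)

lemma dim_rscl [simp]: "dim_row (rscl V k A) = dim_row A" "dim_col (rscl V k A) = dim_col A"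
  by (simp_all add: rscl_def)

lemma rscl_carrier [simp]: "A \<in> carrier_mat m n \<Longrightarrow> rscl V k A \<in> carrier_mat m n"
  by (auto simp: rscl_def)

lemma rscl_index [simp]:
  "i < dim_row A \<Longrightarrow> j < dim_col A \<Longrightarrow> rscl V k A $$ (i, j) = scl V (complex_of_real k) (A $$ (i, j))"
  by (simp add: rscl_def)

lemma dim_unit_mat [simp]: "dim_row (unit_mat V n) = n" "dim_col (unit_mat V n) = n"
  by (simp_all add: unit_mat_def)

lemma unit_mat_carrier [simp]: "unit_mat V n \<in> carrier_mat n n"
  by (simp add: unit_mat_def)

lemma unit_mat_index [simp]:
  "i < n \<Longrightarrow> j < n \<Longrightarrow> unit_mat V n $$ (i, j) = (if i = j then ounit V else 0)"
  by (simp add: unit_mat_def)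

lemma dim_msum [simp]:
  "dim_row (msum A B) = dim_row A + dim_row B" "dim_col (msum A B) = dim_col A + dim_col B"
  by (simp_all add: msum_def)

lemma msum_carrier [simp]:
  "A \<in> carrier_mat m n \<Longrightarrow> B \<in> carrier_mat r s \<Longrightarrow> msum A B \<in> carrier_mat (m + r) (n + s)"
  by (auto intro!: carrier_matI)

lemma msum_index:
  "i < dim_row A + dim_row B \<Longrightarrow> j < dim_col A + dim_col B \<Longrightarrow> msum A B $$ (i, j) =
    (if i < dim_row A then if j < dim_col A then A $$ (i, j) else 0
     else if j < dim_col A then 0 else B $$ (i - dim_row A, j - dim_col A))"
  by (auto simp: msum_def)

lemma msum_assoc: "msum (msum A B) C = msum A (msum B C)"
  unfolding msum_def by (rule assoc_four_block_mat[symmetric])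

lemma msum_zero: "msum (0\<^sub>m m n) (0\<^sub>m r s) = 0\<^sub>m (m + r) (n + s)"
  by (simp add: msum_def)

lemma map_mat_msum: "f 0 = 0 \<Longrightarrow> map_mat f (msum A B) = msum (map_mat f A) (map_mat f B)"
  by (rule eq_matI) (auto simp: msum_index)

lemma map_mat_zero: "f 0 = 0 \<Longrightarrow> map_mat f (0\<^sub>m m n) = 0\<^sub>m m n"
  by (rule eq_matI) auto

lemma msum_left_cancel:
  assumes "msum A B = msum C D" "A \<in> carrier_mat m n" "C \<in> carrier_mat m n"
  shows "A = C"
proof (rule eq_matI)
  fix i j assume ij: "i < dim_row C" "j < dim_col C"
  have "msum A B $$ (i, j) = msum C D $$ (i, j)" using assms(1) by simp
  then show "A $$ (i, j) = C $$ (i, j)" using assms(2,3) ij by (auto simp: msum_index)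
qed (use assms in auto)

lemma mat_star_msum: "s 0 = 0 \<Longrightarrow> mat_star s (msum A B) = msum (mat_star s A) (mat_star s B)"
  by (rule eq_matI) (auto simp: msum_index)

lemma unit_mat_msum: "msum (unit_mat V m) (unit_mat V n) = unit_mat V (m + n)"
  by (rule eq_matI) (auto simp: msum_index)

section \<open>Partial permutation matrices\<close>

text \<open>A bound linear in the norm of \<open>x\<close> is checked once for all vectors and then
  specialised to the unit ball. Upper bounds suffice below, since the operator norm stands on the
  larger side of axiom (2).\<close>

lemma opnorm_le:
  assumes "0 \<le> c" "\<And>x. x \<in> carrier_vec (dim_col \<alpha>) \<Longrightarrow> l2norm (\<alpha> *\<^sub>v x) \<le> c * l2norm x"
  shows "opnorm \<alpha> \<le> c"
  unfolding opnorm_def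
proof (rule cSup_least)
  have "l2norm (0\<^sub>v (dim_col \<alpha>)) \<le> 1" by (simp add: l2norm_def L2_set_def)
  then show "{l2norm (\<alpha> *\<^sub>v x) |x. x \<in> carrier_vec (dim_col \<alpha>) \<and> l2norm x \<le> 1} \<noteq> {}"
    using zero_carrier_vec by blast
next
  fix y assume "y \<in> {l2norm (\<alpha> *\<^sub>v x) |x. x \<in> carrier_vec (dim_col \<alpha>) \<and> l2norm x \<le> 1}"
  then obtain x where x: "y = l2norm (\<alpha> *\<^sub>v x)" "x \<in> carrier_vec (dim_col \<alpha>)" "l2norm x \<le> 1"
    by blast
  have "y \<le> c * l2norm x" using assms(2) x by simp
  also have "\<dots> \<le> c * 1" using assms(1) x(3) by (intro mult_left_mono)
  finally show "y \<le> c" by simp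
qed

lemma opnorm_zero_le: "opnorm (0\<^sub>m r m) \<le> 0"
proof (rule opnorm_le)
  fix x :: "complex vec" assume "x \<in> carrier_vec (dim_col (0\<^sub>m r m :: complex mat))"
  then have "0\<^sub>m r m *\<^sub>v x = 0\<^sub>v r" by auto
  then show "l2norm (0\<^sub>m r m *\<^sub>v x) \<le> 0 * l2norm x" by (simp add: l2norm_def L2_set_def)
qed simp

text \<open>
  Row \<open>i\<close> of the product with this matrix is row \<open>f i\<close> of the other factor, or zero when
  \<open>f i\<close> is out of range.
\<close>

definition select_mat :: "nat \<Rightarrow> nat \<Rightarrow> (nat \<Rightarrow> nat) \<Rightarrow> complex mat" where
  "select_mat r m f = mat r m (\<lambda>(i, j). if j = f i then 1 else 0)"

lemma select_mat_carrier [simp]: "select_mat r m f \<in> carrier_mat r m"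
  by (simp add: select_mat_def)

text \<open>The product lists entries of \<open>x\<close> at the distinct positions
  \<open>f i\<close>, and zeros elsewhere. Its sum of squares is therefore a subsum of that of
  \<open>x\<close>.\<close>

lemma opnorm_select_mat_le:
  assumes "inj_on f {..<r}"
  shows "opnorm (select_mat r m f) \<le> 1"
proof (rule opnorm_le)
  fix x :: "complex vec" assume "x \<in> carrier_vec (dim_col (select_mat r m f))"
  then have x: "dim_vec x = m" by (simp add: select_mat_def)
  have val: "(select_mat r m f *\<^sub>v x) $ i = (if f i < m then x $ f i else 0)" if "i < r" for i
  proof -
    have "(select_mat r m f *\<^sub>v x) $ i = (\<Sum>j<m. (if j = f i then 1 else 0) * x $ j)"
      using that x by (simp add: select_mat_def scalar_prod_def lessThan_atLeast0)
    also have "\<dots> = (\<Sum>j<m. if j = f i then x $ j else 0)"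
      by (intro sum.cong) auto
    finally show ?thesis by (simp add: sum.delta)
  qed
  let ?I = "{i. i < r \<and> f i < m}"
  have "(\<Sum>i<r. (cmod ((select_mat r m f *\<^sub>v x) $ i))\<^sup>2) = (\<Sum>i<r. if f i < m then (cmod (x $ f i))\<^sup>2 else 0)"
    by (intro sum.cong) (auto simp: val)
  also have "\<dots> = (\<Sum>i\<in>?I. (cmod (x $ f i))\<^sup>2)"
    by (intro sum.mono_neutral_cong_right) auto
  also have "\<dots> = (\<Sum>j\<in>f ` ?I. (cmod (x $ j))\<^sup>2)"
    using assms by (subst sum.reindex) (auto simp: inj_on_def)
  also have "\<dots> \<le> (\<Sum>j<m. (cmod (x $ j))\<^sup>2)"
    by (intro sum_mono2) auto
  finally show "l2norm (select_mat r m f *\<^sub>v x) \<le> 1 * l2norm x"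
    using x by (simp add: l2norm_def L2_set_def select_mat_def)
qed simp

section \<open>Involution and scalar matrix multiplication over a matrix ordered space\<close>

context matrix_ordered_space
begin

lemma invol_zero [simp]: "invol V 0 = 0"
  using invol_add[of 0 0] by simp

lemma invol_diff: "invol V (x - y) = invol V x - invol V y"
  using invol_add[of "x - y" y] by simp

lemma mstar_mstar [simp]: "mstar V (mstar V A) = A"
  by (rule eq_matI) (auto simp: invol_invol)

lemma mstar_msum: "mstar V (msum A B) = msum (mstar V A) (mstar V B)"
  by (simp add: mat_star_msum)

lemma mstar_zero [simp]: "mstar V (0\<^sub>m m n) = 0\<^sub>m n m"
  by (rule eq_matI) auto

lemma cone_carrier: "0 < n \<Longrightarrow> u \<in> pcone V n \<Longrightarrow> u \<in> carrier_mat n n"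
  using cone_sa by (auto simp: Msa_def)

lemma rscl_diff_msum:
  assumes "p \<in> carrier_mat m m" "q \<in> carrier_mat n n"
  shows "rscl V k (msum p q) - unit_mat V (m + n)
    = msum (rscl V k p - unit_mat V m) (rscl V k q - unit_mat V n)"
  by (rule eq_matI) (use assms in \<open>auto simp: msum_index\<close>)

lemma lmul_carrier [simp]: "lmul V \<alpha> A \<in> carrier_mat (dim_row \<alpha>) (dim_col A)"
  by (simp add: lmul_def)

lemma rmul_one [simp]: "A \<in> carrier_mat m n \<Longrightarrow> rmul V A (1\<^sub>m n) = A"
proof (rule eq_matI)
  fix i j assume A: "A \<in> carrier_mat m n" and ij: "i < dim_row A" "j < dim_col A"
  have "(\<Sum>k<n. scl V (1\<^sub>m n $$ (k, j)) (A $$ (i, k))) = (\<Sum>k<n. if k = j then A $$ (i, k) else 0)"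
    using A ij by (intro sum.cong) auto
  then show "rmul V A (1\<^sub>m n) $$ (i, j) = A $$ (i, j)"
    using A ij by (simp add: rmul_def sum.delta)
qed (auto simp: rmul_def)

lemma lmul_select_mat:
  assumes "x \<in> carrier_mat m n"
  shows "lmul V (select_mat r m f) x = mat r n (\<lambda>(i, j). if f i < m then x $$ (f i, j) else 0)"
proof (rule eq_matI)
  fix i j
  assume "i < dim_row (mat r n (\<lambda>(i, j). if f i < m then x $$ (f i, j) else 0))"
    "j < dim_col (mat r n (\<lambda>(i, j). if f i < m then x $$ (f i, j) else 0))"
  then have ij: "i < r" "j < n" by auto
  have "(\<Sum>k<m. scl V (select_mat r m f $$ (i, k)) (x $$ (k, j)))
      = (\<Sum>k<m. if k = f i then x $$ (k, j) else 0)"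
    using ij by (intro sum.cong) (auto simp: select_mat_def)
  then show "lmul V (select_mat r m f) x $$ (i, j)
      = mat r n (\<lambda>(i, j). if f i < m then x $$ (f i, j) else 0) $$ (i, j)"
    using ij assms by (simp add: lmul_def sum.delta select_mat_def)
qed (use assms in \<open>auto simp: lmul_def select_mat_def\<close>)

lemma lmul_zero_right: "\<alpha> \<in> carrier_mat r m \<Longrightarrow> lmul V \<alpha> (0\<^sub>m m n) = 0\<^sub>m r n"
  by (rule eq_matI) (auto simp: lmul_def)

end

section \<open>Absolute values and order projections\<close>

context absolute_matrix_order_unit_space
begin

lemma absv_cone: "0 < n \<Longrightarrow> u \<in> pcone V n \<Longrightarrow> absv V u = u"
  using absv_ordered by (auto simp: absolutely_ordered_def)

lemma absv_rscl: "0 < n \<Longrightarrow> u \<in> Msa V n \<Longrightarrow> absv V (rscl V k u) = rscl V \<bar>k\<bar> (absv V u)"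
  using absv_ordered by (auto simp: absolutely_ordered_def)

lemma absv_carrier: "0 < m \<Longrightarrow> 0 < n \<Longrightarrow> v \<in> carrier_mat m n \<Longrightarrow> absv V v \<in> carrier_mat n n"
  using absv_pos cone_carrier by blast

text \<open>
  Properness of the cone at every matrix level: an element \<open>u\<close> of both cones satisfies
  \<open>u = |u| = |- u| = - u\<close>.
\<close>

lemma cone_proper:
  assumes n: "0 < n" and u: "u \<in> pcone V n" and mu: "- u \<in> pcone V n"
  shows "u = 0\<^sub>m n n"
proof -
  have c: "u \<in> carrier_mat n n" using cone_carrier n u by blast
  have neg: "rscl V (- 1) u = - u" and one: "rscl V 1 u = u"
    by (rule eq_matI; use c in auto)+
  have "- u = absv V (rscl V (- 1) u)" using neg absv_cone n mu by simp
  also have "\<dots> = rscl V 1 (absv V u)" using absv_rscl[of n u "- 1"] n u cone_sa by auto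
  finally have e: "- u = u" using absv_cone n u one by simp
  show ?thesis
  proof (rule eq_matI)
    fix i j assume "i < dim_row (0\<^sub>m n n :: 'a mat)" "j < dim_col (0\<^sub>m n n :: 'a mat)"
    then have ij: "i < n" "j < n" by auto
    have "- (u $$ (i, j)) = u $$ (i, j)" using e ij c by (metis carrier_matD index_uminus_mat(1))
    then have "u $$ (i, j) + u $$ (i, j) = 0" by (metis add.left_inverse)
    \<comment> \<open>A mere abelian group could have 2-torsion; the complex scalar action excludes
      it.\<close>
    then have "scl V (1 + 1) (u $$ (i, j)) = 0" by (simp only: scale_left_distrib scale_one)
    then have "u $$ (i, j) = 0" by (subst (asm) scale_eq_0_iff) simp
    then show "u $$ (i, j) = 0\<^sub>m n n $$ (i, j)" using ij by simp
  qed (use c in auto)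
qed

lemma mle_antisym:
  assumes n: "0 < n" and "mle V n u v" "mle V n v u"
  shows "u = v"
proof -
  have c: "u \<in> carrier_mat n n" "v \<in> carrier_mat n n" and uv: "v - u \<in> pcone V n" "u - v \<in> pcone V n"
    using assms by (auto simp: mle_def Msa_def)
  have "- (v - u) = u - v" by (rule eq_matI) (use c in auto)
  then have z: "v - u = 0\<^sub>m n n" using cone_proper[OF n uv(1)] uv(2) by simp
  show ?thesis
  proof (rule eq_matI)
    fix i j assume ij: "i < dim_row v" "j < dim_col v"
    then have "(v - u) $$ (i, j) = 0" using z c by simp
    then show "u $$ (i, j) = v $$ (i, j)" using ij c by simp
  qed (use c in auto)
qed

text \<open>The gap grows by the positive element \<open>rscl V (c - k) w\<close>. Hence an operator
  norm in axiom (2) can be replaced by any upper bound for it.\<close>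

lemma mle_rscl_le:
  assumes n: "0 < n" and le: "mle V n u (rscl V k w)" and w: "w \<in> pcone V n" and "k \<le> c"
  shows "mle V n u (rscl V c w)"
proof -
  have c: "u \<in> carrier_mat n n" "w \<in> carrier_mat n n"
    using le n w cone_carrier by (auto simp: mle_def Msa_def)
  have "rscl V c w - u = (rscl V k w - u) + rscl V (c - k) w"
  proof (rule eq_matI)
    fix i j assume ij: "i < dim_row ((rscl V k w - u) + rscl V (c - k) w)"
      "j < dim_col ((rscl V k w - u) + rscl V (c - k) w)"
    then show "(rscl V c w - u) $$ (i, j) = ((rscl V k w - u) + rscl V (c - k) w) $$ (i, j)"
      using c by (simp add: scale_left_diff_distrib)
  qed (use c in auto)
  moreover have "(rscl V k w - u) + rscl V (c - k) w \<in> pcone V n"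
    using le assms cone_rscl[OF n w, of "c - k"] by (intro cone_add) (auto simp: mle_def)
  moreover have "rscl V c w \<in> Msa V n"
  proof -
    have "mstar V (rscl V c w) = rscl V c (mstar V w)"
      by (rule eq_matI) (auto simp: invol_scl)
    moreover have "mstar V w = w" using cone_sa[OF n] w by (auto simp: Msa_def)
    ultimately show ?thesis using c by (simp add: Msa_def)
  qed
  ultimately show ?thesis using le by (simp add: mle_def)
qed

text \<open>Axiom (2) with the identity matrix on the right: the inner absolute value is positive,
  so taking its absolute value again changes nothing.\<close>

lemma absv_lmul:
  assumes "0 < m" "0 < n" "0 < r" "v \<in> carrier_mat m n" "\<alpha> \<in> carrier_mat r m"
    and "opnorm \<alpha> \<le> c"
  shows "mle V n (absv V (lmul V \<alpha> v)) (rscl V c (absv V v))"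
proof -
  have av: "absv V v \<in> pcone V n" using absv_pos assms by blast
  have "lmul V \<alpha> v \<in> carrier_mat r n" using assms lmul_carrier[of \<alpha> v] by auto
  then have "mle V n (absv V (lmul V \<alpha> v)) (rscl V (opnorm \<alpha>) (absv V v))"
    using absv_mul[of m n r n v \<alpha> "1\<^sub>m n"] assms av cone_carrier[of n "absv V v"]
      absv_cone[of n "absv V v"] by simp
  then show ?thesis using mle_rscl_le assms av by blast
qed

text \<open>Homogeneity concerns self-adjoint square matrices only, so a rectangular zero needs
  axiom (2). Multiplying by the zero scalar matrix bounds the absolute value above by 0, and
  properness finishes.\<close>

lemma absv_zero: "0 < m \<Longrightarrow> 0 < n \<Longrightarrow> absv V (0\<^sub>m m n) = 0\<^sub>m n n"
proof -
  assume mn: "0 < m" "0 < n"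
  let ?a = "absv V (0\<^sub>m m n)"
  have a: "?a \<in> pcone V n" and c: "?a \<in> carrier_mat n n" using absv_pos absv_carrier mn by auto
  have "mle V n (absv V (lmul V (0\<^sub>m m m) (0\<^sub>m m n))) (rscl V 0 ?a)"
    using absv_lmul[of m n m "0\<^sub>m m n" "0\<^sub>m m m" 0] opnorm_zero_le mn by simp
  then have "rscl V 0 ?a - ?a \<in> pcone V n" by (simp add: mle_def lmul_zero_right[of _ m])
  moreover have "rscl V 0 ?a - ?a = - ?a" by (rule eq_matI) (use c in auto)
  ultimately show ?thesis using cone_proper[OF mn(2) a] by simp
qed

text \<open>Each of \<open>x\<close> and \<open>y\<close> arises from the other by selecting rows
  and inserting zero rows, both of which are contractions. The numbers of rows may differ, but both
  absolute values lie at level \<open>n\<close>, where the two inequalities give equality.\<close>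

lemma absv_row_select_eq:
  assumes pos: "0 < m" "0 < n" "0 < r" and x: "x \<in> carrier_mat m n" and y: "y \<in> carrier_mat r n"
    and f: "inj_on f {..<r}" and g: "inj_on g {..<m}"
    and yf: "\<And>i j. i < r \<Longrightarrow> j < n \<Longrightarrow> y $$ (i, j) = (if f i < m then x $$ (f i, j) else 0)"
    and xg: "\<And>i j. i < m \<Longrightarrow> j < n \<Longrightarrow> x $$ (i, j) = (if g i < r then y $$ (g i, j) else 0)"
  shows "absv V y = absv V x"
proof (rule mle_antisym[OF \<open>0 < n\<close>])
  have one: "rscl V 1 (absv V z) = absv V z" for z
    by (rule eq_matI) auto
  have "lmul V (select_mat r m f) x = y"
    unfolding lmul_select_mat[OF x] by (rule eq_matI) (use y yf in auto)
  then show "mle V n (absv V y) (absv V x)"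
    using absv_lmul[OF pos x select_mat_carrier opnorm_select_mat_le[OF f]] one by simp
  have "lmul V (select_mat m r g) y = x"
    unfolding lmul_select_mat[OF y] by (rule eq_matI) (use x xg in auto)
  then show "mle V n (absv V x) (absv V y)"
    using absv_lmul[OF pos(3,2,1) y select_mat_carrier opnorm_select_mat_le[OF g]] one by simp
qed

text \<open>Positivity of the unit is assumed only at level 1. By axiom (3) each larger unit equals
  its own absolute value, and absolute values are positive.\<close>

lemma unit_mat_pos: "0 < n \<Longrightarrow> unit_mat V n \<in> pcone V n"
proof (induction n)
  case (Suc n)
  show ?case
  proof (cases "n = 0")
    case True
    then show ?thesis using unit_pos by simp
  next
    case False
    then have "unit_mat V n \<in> pcone V n" using Suc by simp
    then have "absv V (msum (unit_mat V n) (unit_mat V 1)) = msum (unit_mat V n) (unit_mat V 1)"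
      using absv_msum[of n n 1 1 "unit_mat V n" "unit_mat V 1"] absv_cone[OF _ unit_pos]
        absv_cone[of n "unit_mat V n"] False by simp
    then have "absv V (unit_mat V (Suc n)) = unit_mat V (Suc n)"
      by (simp add: unit_mat_msum)
    then show ?thesis using absv_pos[of "Suc n" "Suc n" "unit_mat V (Suc n)"] by simp
  qed
qed simp

section \<open>Order projections: positivity, block sums and zero\<close>

lemma OP_carrier: "p \<in> OP V n \<Longrightarrow> p \<in> carrier_mat n n"
  by (simp add: OP_def)

lemma OP_mstar: "p \<in> OP V n \<Longrightarrow> mstar V p = p"
  by (simp add: OP_def)

text \<open>For the self-adjoint element s = 2p - e, whose absolute value is e, the sum |s| + s = 2p
  is positive; halving gives p.\<close>

lemma OP_pos:
  assumes n: "0 < n" and p: "p \<in> OP V n"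
  shows "p \<in> pcone V n"
proof -
  have c: "p \<in> carrier_mat n n" and s: "mstar V p = p"
    and a: "absv V (rscl V 2 p - unit_mat V n) = unit_mat V n"
    using p by (auto simp: OP_def)
  have us: "invol V (ounit V) = ounit V"
  proof -
    have "mstar V (unit_mat V 1) = unit_mat V 1" using unit_pos cone_sa[of 1] by (auto simp: Msa_def)
    then have "mstar V (unit_mat V 1) $$ (0, 0) = unit_mat V 1 $$ (0, 0)" by simp
    then show ?thesis by simp
  qed
  have "invol V (p $$ (j, i)) = p $$ (i, j)" if "i < n" "j < n" for i j
    using s that c by (metis carrier_matD mat_star_index)
  then have "mstar V (rscl V 2 p - unit_mat V n) = rscl V 2 p - unit_mat V n"
    using c us by (intro eq_matI) (auto simp: invol_diff invol_scl)
  then have "rscl V 2 p - unit_mat V n \<in> Msa V n" using c by (auto simp: Msa_def)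
  then have "unit_mat V n + (rscl V 2 p - unit_mat V n) \<in> pcone V n"
    using absv_ordered[OF n] a unfolding absolutely_ordered_def by metis
  then have "rscl V (1/2) (unit_mat V n + (rscl V 2 p - unit_mat V n)) \<in> pcone V n"
    using cone_rscl n by simp
  moreover have "rscl V (1/2) (unit_mat V n + (rscl V 2 p - unit_mat V n)) = p"
    by (rule eq_matI) (use c in auto)
  ultimately show ?thesis by simp
qed

lemma OP_absv: "0 < n \<Longrightarrow> p \<in> OP V n \<Longrightarrow> absv V p = p"
  using OP_pos absv_cone by blast

text \<open>The element 2p - e formed for a block sum is again block diagonal, so axiom (3) computes
  its absolute value blockwise.\<close>

lemma OP_msum:
  assumes "0 < m" "0 < n" "p \<in> OP V m" "q \<in> OP V n"
  shows "msum p q \<in> OP V (m + n)"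
proof -
  have c: "p \<in> carrier_mat m m" "q \<in> carrier_mat n n" using assms OP_carrier by auto
  have "absv V (rscl V 2 (msum p q) - unit_mat V (m + n)) = unit_mat V (m + n)"
    using assms c absv_msum[of m m n n "rscl V 2 p - unit_mat V m" "rscl V 2 q - unit_mat V n"]
    by (simp add: rscl_diff_msum OP_def unit_mat_msum minus_carrier_mat)
  then show ?thesis using assms c by (simp add: OP_def mstar_msum)
qed

text \<open>Here 2p - e is -e, whose absolute value is e by homogeneity.\<close>

lemma OP_zero:
  assumes n: "0 < n"
  shows "0\<^sub>m n n \<in> OP V n"
proof -
  have "rscl V 2 (0\<^sub>m n n) - unit_mat V n = rscl V (- 1) (unit_mat V n)"
    by (rule eq_matI) auto
  moreover have "absv V (rscl V (- 1) (unit_mat V n)) = rscl V 1 (unit_mat V n)"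
    using absv_rscl[of n "unit_mat V n" "- 1"] absv_cone[OF n unit_mat_pos[OF n]]
      unit_mat_pos[OF n] cone_sa[OF n] n by auto
  moreover have "rscl V 1 (unit_mat V n) = unit_mat V n"
    by (rule eq_matI) auto
  ultimately show ?thesis by (simp add: OP_def)
qed

lemma OP_infE:
  assumes "p \<in> OP_inf V"
  obtains "0 < dim_row p" "p \<in> OP V (dim_row p)"
proof -
  obtain n where n: "1 \<le> n" "p \<in> OP V n" using assms by (auto simp: OP_inf_def)
  then have "dim_row p = n" using OP_carrier by blast
  then show thesis using that n by simp
qed

lemma OP_inf_absv: "p \<in> OP_inf V \<Longrightarrow> absv V p = p"
  by (erule OP_infE) (rule OP_absv)

lemma OP_inf_mstar: "p \<in> OP_inf V \<Longrightarrow> mstar V p = p"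
  by (erule OP_infE) (rule OP_mstar)

lemma OP_infI: "0 < n \<Longrightarrow> p \<in> OP V n \<Longrightarrow> p \<in> OP_inf V"
  by (force simp: OP_inf_def)

lemma OP_inf_square: "p \<in> OP_inf V \<Longrightarrow> dim_col p = dim_row p"
  by (elim OP_infE) (auto dest: OP_carrier)

lemma OP_inf_msum [intro]: "p \<in> OP_inf V \<Longrightarrow> q \<in> OP_inf V \<Longrightarrow> msum p q \<in> OP_inf V"
  by (elim OP_infE) (auto intro: OP_infI OP_msum simp del: dim_msum)

lemma OP_inf_zero [intro]: "0 < n \<Longrightarrow> 0\<^sub>m n n \<in> OP_inf V"
  using OP_zero OP_infI by blast

section \<open>Equivalence of order projections\<close>

text \<open>That \<open>v\<close> is a partial isometry needs no separate check: its two absolute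
  values are the given order projections.\<close>

lemma proj_equivI:
  assumes "p \<in> OP_inf V" "q \<in> OP_inf V" "v \<in> carrier_mat (dim_row p) (dim_row q)"
    and "absv V (mstar V v) = p" "absv V v = q"
  shows "proj_equiv V p q"
  using assms by (auto simp: proj_equiv_def PI_def elim!: OP_infE)

lemma proj_equivE:
  assumes "proj_equiv V p q"
  obtains v where "v \<in> carrier_mat (dim_row p) (dim_row q)" "absv V (mstar V v) = p" "absv V v = q"
  using assms by (auto simp: proj_equiv_def PI_def)

lemma proj_equiv_refl: "p \<in> OP_inf V \<Longrightarrow> proj_equiv V p p"
  by (rule proj_equivI[of p p p]) (auto elim!: OP_infE simp: OP_carrier OP_mstar OP_absv)

lemma proj_equiv_sym: "p \<in> OP_inf V \<Longrightarrow> q \<in> OP_inf V \<Longrightarrow> proj_equiv V p q \<Longrightarrow> proj_equiv V q p"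
  by (erule proj_equivE) (rule proj_equivI, auto)

lemma proj_equiv_msum:
  assumes P: "p \<in> OP_inf V" "q \<in> OP_inf V" "p' \<in> OP_inf V" "q' \<in> OP_inf V"
    and "proj_equiv V p p'" "proj_equiv V q q'"
  shows "proj_equiv V (msum p q) (msum p' q')"
proof -
  obtain v w where v: "v \<in> carrier_mat (dim_row p) (dim_row p')" "absv V (mstar V v) = p" "absv V v = p'"
    and w: "w \<in> carrier_mat (dim_row q) (dim_row q')" "absv V (mstar V w) = q" "absv V w = q'"
    using assms by (elim proj_equivE)
  have d: "0 < dim_row p" "0 < dim_row q" "0 < dim_row p'" "0 < dim_row q'"
    using P by (auto elim: OP_infE)
  show ?thesis
  proof (rule proj_equivI[of _ _ "msum v w"])
    show "absv V (mstar V (msum v w)) = msum p q"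
      using d v w absv_msum[OF d(3,1,4,2), of "mstar V v" "mstar V w"] by (simp add: mstar_msum)
    show "absv V (msum v w) = msum p' q'"
      using d v w absv_msum[OF d(1,3,2,4), of v w] by simp
  qed (use P v w in auto)
qed

text \<open>The witness \<open>anti p q\<close> has \<open>p\<close> in the upper right and
  \<open>q\<close> in the lower left block. Exchanging its block rows yields
  \<open>msum q p\<close>, which is positive and so is its absolute value. Since \<open>p\<close>
  and \<open>q\<close> are self-adjoint, the adjoint is \<open>anti q p\<close>, to which the same
  argument applies.\<close>

lemma proj_equiv_commute:
  assumes P: "p \<in> OP_inf V" "q \<in> OP_inf V"
  shows "proj_equiv V (msum p q) (msum q p)"
proof -
  define anti where "anti a b = mat (dim_row a + dim_row b) (dim_row b + dim_row a)
    (\<lambda>(i, j). if i < dim_row a then if j < dim_row b then 0 else a $$ (i, j - dim_row b)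
       else if j < dim_row b then b $$ (i - dim_row a, j) else 0)" for a b :: "'a mat"
  have abs: "absv V (anti a b) = msum b a" if "a \<in> OP_inf V" "b \<in> OP_inf V" for a b
  proof -
    have d: "0 < dim_row a" "0 < dim_row b" "dim_col a = dim_row a" "dim_col b = dim_row b"
      using that OP_inf_square by (auto elim: OP_infE)
    define m n where mn: "m = dim_row a" "n = dim_row b"
    \<comment> \<open>This permutation exchanges an initial block of \<open>k\<close> indices with
      the following \<open>l\<close>; swapping \<open>k\<close> and \<open>l\<close> gives its
      inverse.\<close>
    have swap_inj: "inj_on (\<lambda>i. if i < k then l + i else i - k) {..<k + l}" for k l :: nat
    proof (rule inj_onI)
      fix x y assume "x \<in> {..<k + l}" "y \<in> {..<k + l}"
        "(if x < k then l + x else x - k) = (if y < k then l + y else y - k)"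
      then show "x = y" by (cases "x < k"; cases "y < k") auto
    qed
    have "absv V (anti a b) = absv V (msum b a)"
    proof (rule absv_row_select_eq[OF _ _ _ _ _ swap_inj[of m n] swap_inj[of n m]])
      show "anti a b \<in> carrier_mat (m + n) (n + m)" "msum b a \<in> carrier_mat (n + m) (n + m)"
        using d mn by (auto simp: anti_def)
      show "0 < n + m" "0 < n + m" "0 < m + n" using d mn by auto
      fix i j
      show "anti a b $$ (i, j) = (if (if i < m then n + i else i - m) < n + m
          then msum b a $$ (if i < m then n + i else i - m, j) else 0)" if "i < m + n" "j < n + m"
        using that d by (cases "i < m") (auto simp: anti_def msum_index mn)
      show "msum b a $$ (i, j) = (if (if i < n then m + i else i - n) < m + n
          then anti a b $$ (if i < n then m + i else i - n, j) else 0)" if "i < n + m" "j < n + m"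
        using that d by (cases "i < n") (auto simp: anti_def msum_index mn)
    qed
    then show ?thesis using OP_inf_absv[OF OP_inf_msum] that by simp
  qed
  have inv: "invol V (a $$ (j, i)) = a $$ (i, j)"
    if "a \<in> OP_inf V" "i < dim_row a" "j < dim_row a" for a i j
    using that mat_star_index[of i a j "invol V"] OP_inf_mstar[of a] OP_inf_square[of a] by simp
  have "mstar V (anti p q) = anti q p"
    by (rule eq_matI) (use P inv in \<open>auto simp: anti_def\<close>)
  then show ?thesis
    using P abs by (intro proj_equivI[of _ _ "anti p q"] OP_inf_msum) (auto simp: anti_def)
qed

text \<open>The witness is \<open>p\<close> with \<open>k\<close> zero rows below it. Its adjoint is
  \<open>p\<close> with \<open>k\<close> zero columns to the right, which differs from the block sum
  only by zero rows.\<close>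

lemma proj_equiv_msum_zero:
  assumes P: "p \<in> OP_inf V" and k: "0 < k"
  shows "proj_equiv V (msum p (0\<^sub>m k k)) p"
proof -
  let ?m = "dim_row p"
  have d: "0 < ?m" "p \<in> OP V ?m" "dim_col p = ?m" using P OP_inf_square by (auto elim: OP_infE)
  define v where "v = mat (?m + k) ?m (\<lambda>(i, j). if i < ?m then p $$ (i, j) else 0)"
  \<comment> \<open>Selection along the identity only truncates or pads: row indices out of range
    give zero rows.\<close>
  have "absv V v = absv V p"
    by (rule absv_row_select_eq[of ?m ?m "?m + k" _ _ "\<lambda>i. i" "\<lambda>i. i"])
      (use d in \<open>auto simp: v_def OP_carrier\<close>)
  then have 1: "absv V v = p" using d OP_absv by simp
  have inv: "invol V (p $$ (j, i)) = p $$ (i, j)" if "i < ?m" "j < ?m" for i j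
    using that mat_star_index[of i p j "invol V"] OP_inf_mstar[OF P] d by simp
  have "absv V (mstar V v) = absv V (msum p (0\<^sub>m k k))"
    by (rule absv_row_select_eq[of "?m + k" "?m + k" ?m _ _ "\<lambda>i. i" "\<lambda>i. i"])
      (use d inv in \<open>auto simp: v_def msum_index OP_carrier\<close>)
  also have "\<dots> = msum p (0\<^sub>m k k)"
    using OP_absv[of "?m + k"] OP_msum[OF d(1) k d(2) OP_zero[OF k]] k by simp
  finally have 2: "absv V (mstar V v) = msum p (0\<^sub>m k k)" .
  have "v \<in> carrier_mat (dim_row (msum p (0\<^sub>m k k))) (dim_row p)" by (simp add: v_def)
  then show ?thesis by (rule proj_equivI[OF OP_inf_msum[OF P OP_inf_zero[OF k]] P _ 2 1])
qed

end

text \<open>Condition (T) is exactly what makes the equivalence of order projections transitive.\<close>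

locale amous_T = absolute_matrix_order_unit_space +
  assumes cond_T: "condition_T V"
begin

lemma proj_equiv_trans:
  assumes P: "p \<in> OP_inf V" "q \<in> OP_inf V" "r \<in> OP_inf V"
    and "proj_equiv V p q" "proj_equiv V q r"
  shows "proj_equiv V p r"
proof -
  obtain u v where u: "u \<in> PI V (dim_row p) (dim_row q)" "p = absv V (mstar V u)" "q = absv V u"
    and v: "v \<in> PI V (dim_row q) (dim_row r)" "q = absv V (mstar V v)" "r = absv V v"
    using assms(4,5) unfolding proj_equiv_def by blast
  have d: "0 < dim_row p" "0 < dim_row q" "0 < dim_row r" using P by (auto elim: OP_infE)
  \<comment> \<open>Condition (T) compares partial isometries with the same absolute value; here
    \<open>u\<close> and the adjoint of \<open>v\<close> share the absolute value
    \<open>q\<close>.\<close>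
  have "mstar V v \<in> PI V (dim_row r) (dim_row q)" using v(1) by (auto simp: PI_def)
  then obtain w where "w \<in> PI V (dim_row p) (dim_row r)"
    "absv V (mstar V w) = absv V (mstar V u)" "absv V w = absv V (mstar V (mstar V v))"
    using cond_T d u v(2) unfolding condition_T_def by metis
  then show ?thesis using u v unfolding proj_equiv_def by (intro bexI[of _ w]) simp_all
qed

section \<open>Calculus of equivalence and stable equivalence under block sums\<close>

definition eq_proj :: "'a mat \<Rightarrow> 'a mat \<Rightarrow> bool" (infix "\<simeq>" 50) where
  "p \<simeq> q \<longleftrightarrow> p \<in> OP_inf V \<and> q \<in> OP_inf V \<and> proj_equiv V p q"

text \<open>As in \<open>eq_proj\<close>, membership in \<open>OP_inf V\<close> is built in, so that
  transitivity holds without side conditions and can drive calculations.\<close>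

definition eq_stable :: "'a mat \<Rightarrow> 'a mat \<Rightarrow> bool" (infix "\<approx>" 50) where
  "p \<approx> q \<longleftrightarrow> p \<in> OP_inf V \<and> q \<in> OP_inf V \<and> stable_equiv V p q"

lemma eq_proj_refl: "p \<in> OP_inf V \<Longrightarrow> p \<simeq> p"
  by (simp add: eq_proj_def proj_equiv_refl)

lemma eq_proj_sym: "p \<simeq> q \<Longrightarrow> q \<simeq> p"
  by (simp add: eq_proj_def proj_equiv_sym)

lemma eq_proj_trans [trans]: "p \<simeq> q \<Longrightarrow> q \<simeq> r \<Longrightarrow> p \<simeq> r"
  using proj_equiv_trans[of p q r] by (simp add: eq_proj_def)

lemma eq_proj_msum: "p \<simeq> p' \<Longrightarrow> q \<simeq> q' \<Longrightarrow> msum p q \<simeq> msum p' q'"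
  by (simp add: eq_proj_def proj_equiv_msum OP_inf_msum)

lemma eq_proj_commute: "p \<in> OP_inf V \<Longrightarrow> q \<in> OP_inf V \<Longrightarrow> msum p q \<simeq> msum q p"
  by (simp add: eq_proj_def proj_equiv_commute OP_inf_msum)

text \<open>Block sums are associative as an equality of matrices, so only the two middle summands
  have to be commuted.\<close>

lemma eq_proj_interchange:
  assumes P: "a \<in> OP_inf V" "b \<in> OP_inf V" "c \<in> OP_inf V" "d \<in> OP_inf V"
  shows "msum (msum a b) (msum c d) \<simeq> msum (msum a c) (msum b d)"
proof -
  have "msum a (msum (msum b c) d) \<simeq> msum a (msum (msum c b) d)"
    by (rule eq_proj_msum[OF eq_proj_refl eq_proj_msum[OF eq_proj_commute eq_proj_refl]]) (rule P)+
  then show ?thesis by (simp add: msum_assoc)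
qed

lemma eq_proj_swap:
  assumes P: "a \<in> OP_inf V" "b \<in> OP_inf V" "c \<in> OP_inf V" "d \<in> OP_inf V"
  shows "msum (msum a b) (msum c d) \<simeq> msum (msum a d) (msum c b)"
proof -
  have "msum (msum a b) (msum c d) \<simeq> msum (msum a b) (msum d c)"
    by (rule eq_proj_msum[OF eq_proj_refl[OF OP_inf_msum] eq_proj_commute]) (rule P)+
  also have "\<dots> \<simeq> msum (msum a d) (msum b c)"
    by (rule eq_proj_interchange[OF P(1,2,4,3)])
  also have "\<dots> \<simeq> msum (msum a d) (msum c b)"
    by (rule eq_proj_msum[OF eq_proj_refl[OF OP_inf_msum] eq_proj_commute]) (rule P)+
  finally show ?thesis .
qed

lemma eq_stable_iff:
  "p \<approx> q \<longleftrightarrow> p \<in> OP_inf V \<and> q \<in> OP_inf V \<and> (\<exists>r\<in>OP_inf V. msum p r \<simeq> msum q r)"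
  by (auto simp: eq_stable_def stable_equiv_def eq_proj_def)

lemma eq_stableI:
  "p \<in> OP_inf V \<Longrightarrow> q \<in> OP_inf V \<Longrightarrow> r \<in> OP_inf V \<Longrightarrow> msum p r \<simeq> msum q r \<Longrightarrow> p \<approx> q"
  unfolding eq_stable_iff by blast

lemma eq_stableE:
  assumes "p \<approx> q"
  obtains r where "p \<in> OP_inf V" "q \<in> OP_inf V" "r \<in> OP_inf V" "msum p r \<simeq> msum q r"
  using assms unfolding eq_stable_iff by blast

lemma eq_proj_imp_stable:
  assumes "p \<simeq> q"
  shows "p \<approx> q"
proof -
  have z: "0\<^sub>m 1 1 \<in> OP_inf V" by (rule OP_inf_zero) simp
  show ?thesis
    using assms by (intro eq_stableI[OF _ _ z eq_proj_msum[OF assms eq_proj_refl[OF z]]])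
      (simp_all add: eq_proj_def)
qed

lemma eq_stable_refl: "p \<in> OP_inf V \<Longrightarrow> p \<approx> p"
  by (rule eq_proj_imp_stable[OF eq_proj_refl])

lemma eq_stable_sym: "p \<approx> q \<Longrightarrow> q \<approx> p"
  by (elim eq_stableE) (rule eq_stableI, assumption+, erule eq_proj_sym)

text \<open>The block sum of the two stabilising projections stabilises the sum; interchange pairs
  each with its own summand.\<close>

lemma eq_stable_msum:
  assumes "p \<approx> p'" "q \<approx> q'"
  shows "msum p q \<approx> msum p' q'"
proof -
  obtain r where r: "p \<in> OP_inf V" "p' \<in> OP_inf V" "r \<in> OP_inf V" "msum p r \<simeq> msum p' r"
    using assms(1) by (rule eq_stableE)
  obtain s where s: "q \<in> OP_inf V" "q' \<in> OP_inf V" "s \<in> OP_inf V" "msum q s \<simeq> msum q' s"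
    using assms(2) by (rule eq_stableE)
  have "msum (msum p q) (msum r s) \<simeq> msum (msum p r) (msum q s)"
    by (rule eq_proj_interchange) (rule r s)+
  also have "\<dots> \<simeq> msum (msum p' r) (msum q' s)"
    by (rule eq_proj_msum) (rule r s)+
  also have "\<dots> \<simeq> msum (msum p' q') (msum r s)"
    by (rule eq_proj_interchange) (rule r s)+
  finally show ?thesis using r s by (intro eq_stableI[of _ _ "msum r s"] OP_inf_msum)
qed

text \<open>The common stabiliser is \<open>msum r s\<close>: the part \<open>r\<close> carries
  \<open>p\<close> to \<open>q\<close>, the part \<open>s\<close> carries \<open>q\<close> to
  \<open>t\<close>, and commuting the two brings the active one next to the projection.\<close>

lemma eq_stable_trans [trans]:
  assumes "p \<approx> q" "q \<approx> t"
  shows "p \<approx> t"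
proof -
  obtain r where r: "p \<in> OP_inf V" "q \<in> OP_inf V" "r \<in> OP_inf V" "msum p r \<simeq> msum q r"
    using assms(1) by (rule eq_stableE)
  obtain s where s: "t \<in> OP_inf V" "s \<in> OP_inf V" "msum q s \<simeq> msum t s"
    using assms(2) by (rule eq_stableE)
  have rs: "msum r s \<simeq> msum s r" by (rule eq_proj_commute[OF r(3) s(2)])
  have "msum p (msum r s) = msum (msum p r) s" by (rule msum_assoc[symmetric])
  also have "\<dots> \<simeq> msum (msum q r) s" by (rule eq_proj_msum[OF r(4) eq_proj_refl[OF s(2)]])
  also have "msum (msum q r) s = msum q (msum r s)" by (rule msum_assoc)
  also have "\<dots> \<simeq> msum q (msum s r)" by (rule eq_proj_msum[OF eq_proj_refl[OF r(2)] rs])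
  also have "msum q (msum s r) = msum (msum q s) r" by (rule msum_assoc[symmetric])
  also have "\<dots> \<simeq> msum (msum t s) r" by (rule eq_proj_msum[OF s(3) eq_proj_refl[OF r(3)]])
  also have "msum (msum t s) r = msum t (msum s r)" by (rule msum_assoc)
  also have "\<dots> \<simeq> msum t (msum r s)"
    by (rule eq_proj_msum[OF eq_proj_refl[OF s(1)] eq_proj_sym[OF rs]])
  finally show ?thesis using r s by (intro eq_stableI[of _ _ "msum r s"] OP_inf_msum)
qed

text \<open>The cancelled summand \<open>r\<close> is absorbed into the stabilising projection. This
  is the gain of stable equivalence.\<close>

lemma eq_stable_cancel:
  assumes P: "p \<in> OP_inf V" "q \<in> OP_inf V" "r \<in> OP_inf V" and "msum p r \<approx> msum q r"
  shows "p \<approx> q"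
proof -
  obtain s where "s \<in> OP_inf V" "msum (msum p r) s \<simeq> msum (msum q r) s"
    using assms(4) by (rule eq_stableE)
  then show ?thesis
    using P by (intro eq_stableI[of _ _ "msum r s"] OP_inf_msum) (simp_all add: msum_assoc)
qed

section \<open>The group\<close>

lemma K0_rel_iff:
  "((p1, q1), (p2, q2)) \<in> K0_rel V \<longleftrightarrow> p1 \<in> OP_inf V \<and> q1 \<in> OP_inf V \<and> p2 \<in> OP_inf V
    \<and> q2 \<in> OP_inf V \<and> msum p1 q2 \<approx> msum p2 q1"
  by (auto simp: K0_rel_def eq_stable_def)

lemma equiv_K0_rel: "equiv (OP_inf V \<times> OP_inf V) (K0_rel V)"
proof (rule equivI)
  show "K0_rel V \<subseteq> (OP_inf V \<times> OP_inf V) \<times> OP_inf V \<times> OP_inf V" by (auto simp: K0_rel_def)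
  show "refl_on (OP_inf V \<times> OP_inf V) (K0_rel V)"
    by (auto simp: refl_on_def K0_rel_iff intro: eq_stable_refl)
  show "sym (K0_rel V)"
    by (rule symI) (auto simp: K0_rel_iff intro: eq_stable_sym)
  show "trans (K0_rel V)"
  proof (rule transI, clarify)
    fix p1 q1 p2 q2 p3 q3
    assume "((p1, q1), p2, q2) \<in> K0_rel V" "((p2, q2), p3, q3) \<in> K0_rel V"
    then have O: "p1 \<in> OP_inf V" "q1 \<in> OP_inf V" "p2 \<in> OP_inf V" "q2 \<in> OP_inf V"
      "p3 \<in> OP_inf V" "q3 \<in> OP_inf V"
      and 12: "msum p1 q2 \<approx> msum p2 q1" and 23: "msum p2 q3 \<approx> msum p3 q2"
      by (simp_all add: K0_rel_iff)
    \<comment> \<open>As for a Grothendieck group, \<open>msum p2 q2\<close> is added to both sides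
      so that the two hypotheses apply, and is cancelled at the end.\<close>
    have "msum (msum p1 q3) (msum p2 q2) \<approx> msum (msum p1 q2) (msum p2 q3)"
      by (rule eq_proj_imp_stable[OF eq_proj_swap]) (rule O)+
    also have "\<dots> \<approx> msum (msum p2 q1) (msum p3 q2)"
      by (rule eq_stable_msum[OF 12 23])
    also have "\<dots> \<approx> msum (msum p3 q2) (msum p2 q1)"
      by (rule eq_proj_imp_stable[OF eq_proj_commute[OF OP_inf_msum OP_inf_msum]]) (rule O)+
    also have "\<dots> \<approx> msum (msum p3 q1) (msum p2 q2)"
      by (rule eq_proj_imp_stable[OF eq_proj_swap]) (rule O)+
    finally have "msum p1 q3 \<approx> msum p3 q1"
      by (rule eq_stable_cancel[OF OP_inf_msum OP_inf_msum OP_inf_msum, rotated -1]) (rule O)+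
    then show "((p1, q1), p3, q3) \<in> K0_rel V" using O by (simp add: K0_rel_iff)
  qed
qed

lemma K0_class_eq_iff:
  assumes "p1 \<in> OP_inf V" "q1 \<in> OP_inf V" "p2 \<in> OP_inf V" "q2 \<in> OP_inf V"
  shows "K0_class V p1 q1 = K0_class V p2 q2 \<longleftrightarrow> msum p1 q2 \<approx> msum p2 q1"
  using eq_equiv_class_iff[OF equiv_K0_rel, of "(p1, q1)" "(p2, q2)"] assms
  by (simp add: K0_class_def K0_rel_iff)

lemma K0_class_carrier: "p \<in> OP_inf V \<Longrightarrow> q \<in> OP_inf V \<Longrightarrow> K0_class V p q \<in> carrier (K0 V)"
  by (simp add: K0_def K0_class_def quotientI)

lemma K0_carrierE:
  assumes "X \<in> carrier (K0 V)"
  obtains p q where "p \<in> OP_inf V" "q \<in> OP_inf V" "X = K0_class V p q"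
  using assms by (auto simp: K0_def K0_class_def elim: quotientE)

text \<open>This is the form in which addition of pairs has to be checked to be independent of
  representatives.\<close>

lemma eq_stable_interchange_msum:
  assumes O: "a \<in> OP_inf V" "b \<in> OP_inf V" "c \<in> OP_inf V" "d \<in> OP_inf V"
    "a' \<in> OP_inf V" "b' \<in> OP_inf V" "c' \<in> OP_inf V" "d' \<in> OP_inf V"
    and e: "msum a c \<approx> msum a' c'" "msum b d \<approx> msum b' d'"
  shows "msum (msum a b) (msum c d) \<approx> msum (msum a' b') (msum c' d')"
proof -
  have "msum (msum a b) (msum c d) \<approx> msum (msum a c) (msum b d)"
    by (rule eq_proj_imp_stable[OF eq_proj_interchange]) (rule O)+
  also have "\<dots> \<approx> msum (msum a' c') (msum b' d')"
    by (rule eq_stable_msum[OF e])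
  also have "\<dots> \<approx> msum (msum a' b') (msum c' d')"
    by (rule eq_proj_imp_stable[OF eq_proj_interchange]) (rule O)+
  finally show ?thesis .
qed

text \<open>The sum of pairs respects \<open>K0_rel\<close> in both arguments, so the union over
  representatives collapses to one class.\<close>

lemma K0_mult:
  assumes "p1 \<in> OP_inf V" "q1 \<in> OP_inf V" "p2 \<in> OP_inf V" "q2 \<in> OP_inf V"
  shows "K0_class V p1 q1 \<otimes>\<^bsub>K0 V\<^esub> K0_class V p2 q2 = K0_class V (msum p1 p2) (msum q1 q2)"
proof -
  let ?f = "\<lambda>x y. K0_class V (msum (fst x) (fst y)) (msum (snd x) (snd y))"
  have "congruent2 (K0_rel V) (K0_rel V) ?f"
  proof (rule congruent2I', clarify)
    fix a b a' b' c d c' d'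
    assume "((a, b), a', b') \<in> K0_rel V" "((c, d), c', d') \<in> K0_rel V"
    then show "?f (a, b) (c, d) = ?f (a', b') (c', d')"
      by (simp add: K0_rel_iff K0_class_eq_iff OP_inf_msum eq_stable_interchange_msum)
  qed
  from UN_equiv_class2[OF equiv_K0_rel equiv_K0_rel this, of "(p1, q1)" "(p2, q2)"]
  show ?thesis using assms by (simp add: K0_def K0_class_def case_prod_unfold)
qed

lemma K0_mult_closed: "X \<in> carrier (K0 V) \<Longrightarrow> Y \<in> carrier (K0 V) \<Longrightarrow> X \<otimes>\<^bsub>K0 V\<^esub> Y \<in> carrier (K0 V)"
  by (elim K0_carrierE) (simp add: K0_mult K0_class_carrier OP_inf_msum)

lemma K0_one: "\<one>\<^bsub>K0 V\<^esub> = K0_class V (0\<^sub>m 1 1) (0\<^sub>m 1 1)"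
  by (simp add: K0_def)

lemma K0_one_closed: "\<one>\<^bsub>K0 V\<^esub> \<in> carrier (K0 V)"
  unfolding K0_one by (rule K0_class_carrier) (simp_all add: OP_inf_zero)

text \<open>Both zeros are equivalent to the zero of size \<open>m + n\<close>, by splitting off a
  zero block in either order.\<close>

lemma eq_proj_zero:
  assumes "0 < m" "0 < n"
  shows "0\<^sub>m m m \<simeq> 0\<^sub>m n n"
proof -
  have z: "0\<^sub>m (k + l) (k + l) \<simeq> 0\<^sub>m k k" if "0 < k" "0 < l" for k l
    using proj_equiv_msum_zero[OF OP_inf_zero[OF that(1)] that(2)] OP_inf_zero that
    by (simp add: eq_proj_def msum_zero)
  have "0\<^sub>m m m \<simeq> 0\<^sub>m (m + n) (m + n)" by (rule eq_proj_sym[OF z[OF assms]])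
  also have "0\<^sub>m (m + n) (m + n) = 0\<^sub>m (n + m) (n + m)" by (simp add: add.commute)
  also have "\<dots> \<simeq> 0\<^sub>m n n" by (rule z[OF assms(2,1)])
  finally show ?thesis .
qed

text \<open>The identity is fixed with zeros of size 1, while the zero map produces a zero of the
  size of the projection; this bridges the two.\<close>

lemma K0_class_zero:
  assumes "0 < m" "0 < n"
  shows "K0_class V (0\<^sub>m m m) (0\<^sub>m n n) = \<one>\<^bsub>K0 V\<^esub>"
proof -
  have "0\<^sub>m (m + 1) (m + 1) \<approx> 0\<^sub>m (1 + n) (1 + n)"
    by (rule eq_proj_imp_stable[OF eq_proj_zero]) simp_all
  then show ?thesis
    using assms K0_class_eq_iff[of "0\<^sub>m m m" "0\<^sub>m n n" "0\<^sub>m 1 1" "0\<^sub>m 1 1"]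
    by (simp add: K0_one OP_inf_zero msum_zero)
qed

lemma K0_one_mult_one: "\<one>\<^bsub>K0 V\<^esub> \<otimes>\<^bsub>K0 V\<^esub> \<one>\<^bsub>K0 V\<^esub> = \<one>\<^bsub>K0 V\<^esub>"
proof -
  have "\<one>\<^bsub>K0 V\<^esub> \<otimes>\<^bsub>K0 V\<^esub> \<one>\<^bsub>K0 V\<^esub> = K0_class V (0\<^sub>m (1 + 1) (1 + 1)) (0\<^sub>m (1 + 1) (1 + 1))"
    unfolding K0_one by (subst K0_mult) (simp_all add: OP_inf_zero msum_zero)
  also have "\<dots> = \<one>\<^bsub>K0 V\<^esub>" by (rule K0_class_zero) simp_all
  finally show ?thesis .
qed

text \<open>Cancellation of classes comes from cancellation of the summand \<open>msum e f\<close>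
  in stable equivalence. It is what makes homomorphisms into this group unique.\<close>

lemma K0_right_cancel:
  assumes X: "X \<in> carrier (K0 V)" "Y \<in> carrier (K0 V)" "Z \<in> carrier (K0 V)"
    and eq: "X \<otimes>\<^bsub>K0 V\<^esub> Z = Y \<otimes>\<^bsub>K0 V\<^esub> Z"
  shows "X = Y"
proof -
  obtain a b c d e f where O: "a \<in> OP_inf V" "b \<in> OP_inf V" "c \<in> OP_inf V" "d \<in> OP_inf V"
      "e \<in> OP_inf V" "f \<in> OP_inf V"
    and X: "X = K0_class V a b" and Y: "Y = K0_class V c d" and Z: "Z = K0_class V e f"
    using X by (elim K0_carrierE)
  have "msum (msum a d) (msum e f) \<approx> msum (msum a e) (msum d f)"
    by (rule eq_proj_imp_stable[OF eq_proj_interchange]) (rule O)+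
  also have "\<dots> \<approx> msum (msum c e) (msum b f)"
    using eq by (simp add: X Y Z K0_mult K0_class_eq_iff O OP_inf_msum)
  also have "\<dots> \<approx> msum (msum c b) (msum e f)"
    by (rule eq_proj_imp_stable[OF eq_proj_interchange]) (rule O)+
  finally have "msum a d \<approx> msum c b"
    by (rule eq_stable_cancel[OF OP_inf_msum OP_inf_msum OP_inf_msum, rotated -1]) (rule O)+
  then show ?thesis by (simp add: X Y K0_class_eq_iff O)
qed

text \<open>After cross-adding, both sides contain the same three summands and agree by
  associativity. The case of zero \<open>r\<close> expresses any class through classes of single
  projections.\<close>

lemma K0_class_decompose:
  assumes O: "p \<in> OP_inf V" "q \<in> OP_inf V" "r \<in> OP_inf V"
  shows "K0_class V p q \<otimes>\<^bsub>K0 V\<^esub> K0_class V q r = K0_class V p r"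
proof -
  have "msum (msum p q) r \<approx> msum p (msum q r)"
    unfolding msum_assoc by (intro eq_stable_refl OP_inf_msum O)
  then show ?thesis by (simp add: K0_mult K0_class_eq_iff O OP_inf_msum)
qed

end

section \<open>Induced homomorphisms\<close>

text \<open>Existence is witnessed by \<open>h\<close> itself, and uniqueness follows from
  decomposition and cancellation. The map \<phi> enters only through the prescribed values, so
  unital maps, composites and the zero map are treated alike.\<close>

lemma K0_map_eqI:
  assumes V: "amous_T V" and W: "amous_T W"
    and h: "h \<in> hom (K0 V) (K0 W)" "h \<in> extensional (carrier (K0 V))"
    and hp: "\<And>p. p \<in> OP_inf V \<Longrightarrow> h (K0_class V p (0\<^sub>m 1 1)) = K0_class W (map_mat \<phi> p) (0\<^sub>m 1 1)"
  shows "K0_map V W \<phi> = h"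
  unfolding K0_map_def
proof (rule the_equality)
  show "h \<in> hom (K0 V) (K0 W) \<and> h \<in> extensional (carrier (K0 V)) \<and>
    (\<forall>p\<in>OP_inf V. h (K0_class V p (0\<^sub>m 1 1)) = K0_class W (map_mat \<phi> p) (0\<^sub>m 1 1))"
    using h hp by blast
next
  interpret V: amous_T V by (rule V)
  interpret W: amous_T W by (rule W)
  fix g assume g: "g \<in> hom (K0 V) (K0 W) \<and> g \<in> extensional (carrier (K0 V)) \<and>
    (\<forall>p\<in>OP_inf V. g (K0_class V p (0\<^sub>m 1 1)) = K0_class W (map_mat \<phi> p) (0\<^sub>m 1 1))"
  have 0: "0\<^sub>m 1 1 \<in> OP_inf V" by (rule V.OP_inf_zero) simp
  show "g = h"
  proof (rule extensionalityI[of g "carrier (K0 V)" h])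
    fix X assume X: "X \<in> carrier (K0 V)"
    then obtain p q where pq: "p \<in> OP_inf V" "q \<in> OP_inf V" "X = K0_class V p q"
      by (rule V.K0_carrierE)
    let ?Q = "K0_class V q (0\<^sub>m 1 1)"
    have Q: "?Q \<in> carrier (K0 V)" using V.K0_class_carrier pq 0 by blast
    \<comment> \<open>Any homomorphism \<open>f\<close> satisfies this relation, and its values at
      \<open>?Q\<close> and at the class on the right are prescribed; hence \<open>f X\<close> is
      determined.\<close>
    have mult: "f X \<otimes>\<^bsub>K0 W\<^esub> f ?Q = f (K0_class V p (0\<^sub>m 1 1))" if "f \<in> hom (K0 V) (K0 W)" for f
      using that X Q V.K0_class_decompose[OF pq(1,2) 0] pq(3) hom_mult[OF that X Q] by simp
    have "g X \<otimes>\<^bsub>K0 W\<^esub> h ?Q = h X \<otimes>\<^bsub>K0 W\<^esub> h ?Q"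
      using mult[of g] mult[of h] g h(1) hp pq by simp
    moreover have "g X \<in> carrier (K0 W)" "h X \<in> carrier (K0 W)" "h ?Q \<in> carrier (K0 W)"
      using g h(1) X Q by (auto intro: hom_in_carrier)
    ultimately show "g X = h X" using W.K0_right_cancel by blast
  qed (use g h in auto)
qed

section \<open>The homomorphism induced by a unital completely absolute-value preserving map\<close>

locale unital_abs_preserving = V: amous_T V + W: amous_T W
  for V :: "('v::ab_group_add, 'y) amous_scheme" and W :: "('w::ab_group_add, 'z) amous_scheme" +
  fixes \<phi> :: "'v \<Rightarrow> 'w"
  assumes preserving: "completely_abs_preserving V W \<phi>" and unital: "unital V W \<phi>"
begin

sublocale Vector_Spaces.linear "scl V" "scl W" \<phi>
  using preserving by (simp add: completely_abs_preserving_def star_linear_def)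

lemma map_invol: "\<phi> (invol V x) = invol W (\<phi> x)"
  using preserving by (simp add: completely_abs_preserving_def star_linear_def)

lemma map_mstar: "map_mat \<phi> (mstar V A) = mstar W (map_mat \<phi> A)"
  by (rule eq_matI) (auto simp: map_invol)

lemma absv_map_square: "0 < n \<Longrightarrow> v \<in> carrier_mat n n \<Longrightarrow> absv W (map_mat \<phi> v) = map_mat \<phi> (absv V v)"
  using preserving by (simp add: completely_abs_preserving_def)

lemma map_msum: "map_mat \<phi> (msum A B) = msum (map_mat \<phi> A) (map_mat \<phi> B)"
  by (simp add: map_mat_msum zero)

lemma map_zero_mat: "map_mat \<phi> (0\<^sub>m m n) = 0\<^sub>m m n"
  by (simp add: map_mat_zero zero)

text \<open>The hypothesis only concerns square matrices; a rectangular one is padded by a zero block.\<close>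

lemma absv_map:
  assumes mn: "0 < m" "0 < n" and v: "v \<in> carrier_mat m n"
  shows "absv W (map_mat \<phi> v) = map_mat \<phi> (absv V v)"
proof -
  have c: "msum v (0\<^sub>m n m) \<in> carrier_mat (m + n) (m + n)"
    using msum_carrier[OF v zero_carrier_mat[of n m]] by (simp add: add.commute)
  have "msum (absv W (map_mat \<phi> v)) (0\<^sub>m m m) = absv W (map_mat \<phi> (msum v (0\<^sub>m n m)))"
    using W.absv_msum[of m n n m "map_mat \<phi> v" "0\<^sub>m n m"] mn v
    by (simp add: map_msum map_zero_mat W.absv_zero)
  also have "\<dots> = map_mat \<phi> (absv V (msum v (0\<^sub>m n m)))"
    using absv_map_square[OF _ c] mn by simp
  also have "\<dots> = msum (map_mat \<phi> (absv V v)) (0\<^sub>m m m)"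
    using V.absv_msum[of m n n m v "0\<^sub>m n m"] mn v
    by (simp add: map_msum map_zero_mat V.absv_zero)
  finally show ?thesis
    by (rule msum_left_cancel[of _ _ _ _ n n])
      (use W.absv_carrier[OF mn] V.absv_carrier[OF mn v] v in auto)
qed

text \<open>Unitality makes \<phi> carry 2p - e to the corresponding element of the image, and
  preservation of absolute values does the rest.\<close>

lemma map_OP:
  assumes n: "0 < n" and p: "p \<in> OP V n"
  shows "map_mat \<phi> p \<in> OP W n"
proof -
  have c: "p \<in> carrier_mat n n" using p by (rule V.OP_carrier)
  have u: "\<phi> (ounit V) = ounit W" using unital by (simp add: unital_def)
  have e: "map_mat \<phi> (unit_mat V n) = unit_mat W n"
    by (rule eq_matI) (simp_all add: u zero)
  have "rscl W 2 (map_mat \<phi> p) - unit_mat W n = map_mat \<phi> (rscl V 2 p - unit_mat V n)"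
    by (rule eq_matI) (use c in \<open>simp_all add: u zero diff scale\<close>)
  then have "absv W (rscl W 2 (map_mat \<phi> p) - unit_mat W n) = unit_mat W n"
    using absv_map_square[OF n, of "rscl V 2 p - unit_mat V n"] p e
    by (simp add: OP_def minus_carrier_mat)
  moreover have "mstar W (map_mat \<phi> p) = map_mat \<phi> p"
    using V.OP_mstar[OF p] map_mstar[of p] by simp
  ultimately show ?thesis using c by (simp add: OP_def)
qed

lemma map_OP_inf: "p \<in> OP_inf V \<Longrightarrow> map_mat \<phi> p \<in> OP_inf W"
  by (erule V.OP_infE) (rule W.OP_infI[OF _ map_OP])

text \<open>The image of a partial isometry is the new witness; since it may be rectangular,
  \<open>absv_map\<close> is used rather than the square case.\<close>

lemma map_proj_equiv:
  assumes P: "p \<in> OP_inf V" "q \<in> OP_inf V" and "proj_equiv V p q"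
  shows "proj_equiv W (map_mat \<phi> p) (map_mat \<phi> q)"
proof -
  obtain v where v: "v \<in> carrier_mat (dim_row p) (dim_row q)" "absv V (mstar V v) = p" "absv V v = q"
    using assms by (elim V.proj_equivE)
  have d: "0 < dim_row p" "0 < dim_row q" using P by (auto elim: V.OP_infE)
  have 1: "absv W (mstar W (map_mat \<phi> v)) = map_mat \<phi> p"
    using absv_map[OF d(2,1), of "mstar V v"] v by (simp add: map_mstar)
  have 2: "absv W (map_mat \<phi> v) = map_mat \<phi> q" using absv_map[OF d v(1)] v(3) by simp
  have "map_mat \<phi> v \<in> carrier_mat (dim_row (map_mat \<phi> p)) (dim_row (map_mat \<phi> q))"
    using v(1) by simp
  then show ?thesis by (rule W.proj_equivI[OF map_OP_inf[OF P(1)] map_OP_inf[OF P(2)] _ 1 2])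
qed

lemma map_eq_stable:
  assumes "V.eq_stable p q"
  shows "W.eq_stable (map_mat \<phi> p) (map_mat \<phi> q)"
proof -
  obtain r where P: "p \<in> OP_inf V" "q \<in> OP_inf V" "r \<in> OP_inf V"
    and e: "V.eq_proj (msum p r) (msum q r)"
    using assms by (rule V.eq_stableE)
  have "proj_equiv W (map_mat \<phi> (msum p r)) (map_mat \<phi> (msum q r))"
    using e by (intro map_proj_equiv) (simp_all add: V.eq_proj_def)
  then have "W.eq_proj (msum (map_mat \<phi> p) (map_mat \<phi> r)) (msum (map_mat \<phi> q) (map_mat \<phi> r))"
    using P by (simp add: map_msum W.eq_proj_def map_OP_inf W.OP_inf_msum)
  then show ?thesis by (rule W.eq_stableI[OF P[THEN map_OP_inf]])
qed

text \<open>\<phi> is applied to both components of every representative. The union is a single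
  class by \<open>map_eq_stable\<close>, and the restriction makes the map extensional.\<close>

definition induced :: "('v mat \<times> 'v mat) set \<Rightarrow> ('w mat \<times> 'w mat) set" where
  "induced = (\<lambda>X\<in>carrier (K0 V). \<Union>x\<in>X. K0_class W (map_mat \<phi> (fst x)) (map_mat \<phi> (snd x)))"

lemma induced_class:
  assumes "p \<in> OP_inf V" "q \<in> OP_inf V"
  shows "induced (K0_class V p q) = K0_class W (map_mat \<phi> p) (map_mat \<phi> q)"
proof -
  let ?f = "\<lambda>x. K0_class W (map_mat \<phi> (fst x)) (map_mat \<phi> (snd x))"
  have "?f respects K0_rel V"
  proof (rule congruentI, clarify)
    fix p1 q1 p2 q2 assume "((p1, q1), p2, q2) \<in> K0_rel V"
    then have O: "p1 \<in> OP_inf V" "q1 \<in> OP_inf V" "p2 \<in> OP_inf V" "q2 \<in> OP_inf V"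
      and s: "V.eq_stable (msum p1 q2) (msum p2 q1)"
      by (simp_all add: V.K0_rel_iff)
    have "W.eq_stable (map_mat \<phi> (msum p1 q2)) (map_mat \<phi> (msum p2 q1))"
      by (rule map_eq_stable[OF s])
    then show "?f (p1, q1) = ?f (p2, q2)"
      using O by (simp add: W.K0_class_eq_iff map_OP_inf map_msum)
  qed
  from UN_equiv_class[OF V.equiv_K0_rel this, of "(p, q)"] show ?thesis
    using assms V.K0_class_carrier[OF assms] by (simp add: induced_def K0_class_def)
qed

lemma induced_hom: "induced \<in> hom (K0 V) (K0 W)"
proof (rule homI)
  fix X Y assume "X \<in> carrier (K0 V)" "Y \<in> carrier (K0 V)"
  then obtain a b c d where "a \<in> OP_inf V" "b \<in> OP_inf V" "X = K0_class V a b"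
      "c \<in> OP_inf V" "d \<in> OP_inf V" "Y = K0_class V c d"
    by (elim V.K0_carrierE)
  then show "induced (X \<otimes>\<^bsub>K0 V\<^esub> Y) = induced X \<otimes>\<^bsub>K0 W\<^esub> induced Y"
    by (simp add: V.K0_mult W.K0_mult induced_class map_OP_inf V.OP_inf_msum map_msum)
next
  fix X assume "X \<in> carrier (K0 V)"
  then show "induced X \<in> carrier (K0 W)"
    by (elim V.K0_carrierE) (simp add: induced_class W.K0_class_carrier map_OP_inf)
qed

lemma K0_map_induced: "K0_map V W \<phi> = induced"
proof (rule K0_map_eqI[OF V.amous_T_axioms W.amous_T_axioms induced_hom])
  show "induced \<in> extensional (carrier (K0 V))" by (simp add: induced_def)
  fix p assume "p \<in> OP_inf V"
  then show "induced (K0_class V p (0\<^sub>m 1 1)) = K0_class W (map_mat \<phi> p) (0\<^sub>m 1 1)"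
    using induced_class[of p "0\<^sub>m 1 1"] V.OP_inf_zero[of 1] by (simp add: map_zero_mat)
qed

end

section \<open>Identity, zero map and composition\<close>

lemma K0_map_id:
  assumes "amous_T V"
  shows "K0_map V V (\<lambda>x. x) = (\<lambda>X\<in>carrier (K0 V). X)"
proof (rule K0_map_eqI[OF assms assms])
  interpret amous_T V by (rule assms)
  show "(\<lambda>X\<in>carrier (K0 V). X) \<in> hom (K0 V) (K0 V)"
    by (rule homI) (auto simp: K0_mult_closed)
  fix p assume "p \<in> OP_inf V"
  moreover have "map_mat (\<lambda>x. x) p = p" by (rule eq_matI) auto
  ultimately show "(\<lambda>X\<in>carrier (K0 V). X) (K0_class V p (0\<^sub>m 1 1)) = K0_class V (map_mat (\<lambda>x. x) p) (0\<^sub>m 1 1)"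
    using K0_class_carrier[of p "0\<^sub>m 1 1"] OP_inf_zero[of 1] by simp
qed simp

text \<open>The zero map need not be unital, so the characterisation \<open>K0_map_eqI\<close> is
  applied directly to the constant map.\<close>

lemma K0_map_zero:
  fixes V :: "('v::ab_group_add, 'y) amous_scheme" and W :: "('w::ab_group_add, 'z) amous_scheme"
  assumes "amous_T V" "amous_T W"
  shows "K0_map V W (\<lambda>_. 0) = (\<lambda>X\<in>carrier (K0 V). \<one>\<^bsub>K0 W\<^esub>)"
proof (rule K0_map_eqI[OF assms])
  interpret V: amous_T V by (rule assms)
  interpret W: amous_T W by (rule assms)
  show "(\<lambda>X\<in>carrier (K0 V). \<one>\<^bsub>K0 W\<^esub>) \<in> hom (K0 V) (K0 W)"
    by (rule homI) (auto simp: V.K0_mult_closed W.K0_one_closed W.K0_one_mult_one)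
  fix p assume p: "p \<in> OP_inf V"
  then have "map_mat (\<lambda>_. 0 :: 'w) p = 0\<^sub>m (dim_row p) (dim_row p)"
    using V.OP_inf_square[OF p] by (intro eq_matI) auto
  moreover have "0 < dim_row p" using p by (rule V.OP_infE)
  ultimately show "(\<lambda>X\<in>carrier (K0 V). \<one>\<^bsub>K0 W\<^esub>) (K0_class V p (0\<^sub>m 1 1))
      = K0_class W (map_mat (\<lambda>_. 0) p) (0\<^sub>m 1 1)"
    using V.K0_class_carrier[of p "0\<^sub>m 1 1"] V.OP_inf_zero[of 1] p W.K0_class_zero[of "dim_row p" 1] by simp
qed simp

text \<open>The composite of the two induced homomorphisms is checked against the characterisation
  of the map induced by \<psi> \<circ> \<phi>; on classes of single projections both apply \<phi>
  and then \<psi>.\<close>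

lemma K0_map_comp:
  assumes "unital_abs_preserving U V \<phi>" "unital_abs_preserving V W \<psi>"
  shows "K0_map U W (\<psi> \<circ> \<phi>) = compose (carrier (K0 U)) (K0_map V W \<psi>) (K0_map U V \<phi>)"
proof -
  interpret f: unital_abs_preserving U V \<phi> by (rule assms)
  interpret g: unital_abs_preserving V W \<psi> by (rule assms)
  show ?thesis
    unfolding f.K0_map_induced g.K0_map_induced
  proof (rule K0_map_eqI[OF f.V.amous_T_axioms g.W.amous_T_axioms])
    show "compose (carrier (K0 U)) g.induced f.induced \<in> hom (K0 U) (K0 W)"
      by (rule homI) (simp_all add: compose_eq f.V.K0_mult_closed hom_mult[OF f.induced_hom]
        hom_mult[OF g.induced_hom] hom_in_carrier[OF f.induced_hom] hom_in_carrier[OF g.induced_hom])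
    fix p assume p: "p \<in> OP_inf U"
    have z: "0\<^sub>m 1 1 \<in> OP_inf U" "0\<^sub>m 1 1 \<in> OP_inf V"
      using f.V.OP_inf_zero[of 1] f.W.OP_inf_zero[of 1] by auto
    have "map_mat (\<psi> \<circ> \<phi>) p = map_mat \<psi> (map_mat \<phi> p)" by (rule eq_matI) auto
    then show "compose (carrier (K0 U)) g.induced f.induced (K0_class U p (0\<^sub>m 1 1))
        = K0_class W (map_mat (\<psi> \<circ> \<phi>) p) (0\<^sub>m 1 1)"
      using p z by (simp add: compose_eq f.V.K0_class_carrier f.induced_class g.induced_class
          f.map_OP_inf f.map_zero_mat g.map_zero_mat)
  qed simp
qed

theorem corollary5p3:
  fixes U :: "'u::ab_group_add amous"
    and V :: "'v::ab_group_add amous"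
    and W :: "'w::ab_group_add amous"
  assumes "absolute_matrix_order_unit_space U" and "condition_T U"
    and "absolute_matrix_order_unit_space V" and "condition_T V"
    and "absolute_matrix_order_unit_space W" and "condition_T W"
  shows "K0_map V V (\<lambda>x. x) = (\<lambda>X\<in>carrier (K0 V). X)
    \<and> (\<forall>\<phi> \<psi>. completely_abs_preserving U V \<phi> \<and> unital U V \<phi>
          \<and> completely_abs_preserving V W \<psi> \<and> unital V W \<psi>
         \<longrightarrow> K0_map U W (\<psi> \<circ> \<phi>) = compose (carrier (K0 U)) (K0_map V W \<psi>) (K0_map U V \<phi>))
    \<and> K0_map V W (\<lambda>_. 0) = (\<lambda>X\<in>carrier (K0 V). \<one>\<^bsub>K0 W\<^esub>)"
proof -
  have T: "amous_T U" "amous_T V" "amous_T W"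
    using assms by (auto intro!: amous_T.intro amous_T_axioms.intro)
  then show ?thesis
    using K0_map_id K0_map_zero
    by (auto intro!: K0_map_comp unital_abs_preserving.intro unital_abs_preserving_axioms.intro)
qed

end
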